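(* Let $\kappa$ be an infinite cardinal, let $X$ be a set with $|X|\geq\kappa^+$, and let $\mathcal F$ be a family of subsets of $X$, each of cardinality $<\kappa$, such that every finite subset of $X$ is contained in some member of $\mathcal F$. Then the two-sorted structure $(X,\mathcal F;\in)$, whose only relation is membership $\in\subseteq X\times\mathcal F$, has IP (i.e., its complete theory is not NIP).
   Context: For a set $Y$ and $\mathcal G\subseteq\mathcal P(Y)$, a subset $A\subseteq Y$ is shattered by $\mathcal G$ if for every $S\subseteq A$ there is $G\in\mathcal G$ with $G\cap A=S$. A partitioned formula $\phi(x,y)$ is NIP in a structure $N$ if for some $n<\omega$ no subset of $N^x$ of size $n$ is shattered by $\{\phi(N^x,b): b\in N^y\}$, and IP otherwise. A structure has IP if some partitioned formula (in its language, without parameters) has IP in it; otherwise it is NIP. *)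

theory Defs
  imports "HOL-Library.FuncSet"
begin

unbundle cardinal_syntax

text \<open>
  Many-sorted first-order logic with equality over a relational language: a variable is a
  sort together with an index, \<open>rank\<close> gives the sorts of the arguments of a relation symbol,
  and the elements of all sorts live in one type \<open>'a\<close>. Sorts are allowed to be empty.
\<close>

type_synonym 's var = "'s \<times> nat"

datatype ('s, 'r) fm =
    Bot
  | Eq "'s var" "'s var"
  | Rel 'r "'s var list"
  | Neg "('s, 'r) fm"
  | Conj "('s, 'r) fm" "('s, 'r) fm"
  | Exi "'s var" "('s, 'r) fm"

record ('s, 'r, 'a) struct =
  rank :: "'r \<Rightarrow> 's list"
  dom_of :: "'s \<Rightarrow> 'a set"
  interp :: "'r \<Rightarrow> 'a list set"

primrec well_sorted :: "('r \<Rightarrow> 's list) \<Rightarrow> ('s, 'r) fm \<Rightarrow> bool" where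
  "well_sorted ar Bot \<longleftrightarrow> True"
| "well_sorted ar (Eq u v) \<longleftrightarrow> fst u = fst v"
| "well_sorted ar (Rel r vs) \<longleftrightarrow> map fst vs = ar r"
| "well_sorted ar (Neg \<phi>) \<longleftrightarrow> well_sorted ar \<phi>"
| "well_sorted ar (Conj \<phi> \<psi>) \<longleftrightarrow> well_sorted ar \<phi> \<and> well_sorted ar \<psi>"
| "well_sorted ar (Exi v \<phi>) \<longleftrightarrow> well_sorted ar \<phi>"

primrec free_vars :: "('s, 'r) fm \<Rightarrow> 's var set" where
  "free_vars Bot = {}"
| "free_vars (Eq u v) = {u, v}"
| "free_vars (Rel r vs) = set vs"
| "free_vars (Neg \<phi>) = free_vars \<phi>"
| "free_vars (Conj \<phi> \<psi>) = free_vars \<phi> \<union> free_vars \<psi>"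
| "free_vars (Exi v \<phi>) = free_vars \<phi> - {v}"

primrec sat :: "('s, 'r, 'a) struct \<Rightarrow> ('s var \<Rightarrow> 'a) \<Rightarrow> ('s, 'r) fm \<Rightarrow> bool" where
  "sat N e Bot \<longleftrightarrow> False"
| "sat N e (Eq u v) \<longleftrightarrow> e u = e v"
| "sat N e (Rel r vs) \<longleftrightarrow> map e vs \<in> interp N r"
| "sat N e (Neg \<phi>) \<longleftrightarrow> \<not> sat N e \<phi>"
| "sat N e (Conj \<phi> \<psi>) \<longleftrightarrow> sat N e \<phi> \<and> sat N e \<psi>"
| "sat N e (Exi v \<phi>) \<longleftrightarrow> (\<exists>a \<in> dom_of N (fst v). sat N (e(v := a)) \<phi>)"

text \<open>
  A tuple of variables is a finite set \<open>x\<close> of variables; \<open>N\<^sup>x\<close> is the set of sort-respecting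
  assignments on \<open>x\<close>.
\<close>

definition tuples :: "('s, 'r, 'a) struct \<Rightarrow> 's var set \<Rightarrow> ('s var \<Rightarrow> 'a) set" where
  "tuples N x = (\<Pi>\<^sub>E v\<in>x. dom_of N (fst v))"

definition partitioned_fm ::
    "('r \<Rightarrow> 's list) \<Rightarrow> ('s, 'r) fm \<Rightarrow> 's var set \<Rightarrow> 's var set \<Rightarrow> bool" where
  "partitioned_fm ar \<phi> x y \<longleftrightarrow>
     well_sorted ar \<phi> \<and> finite x \<and> finite y \<and> x \<inter> y = {} \<and> free_vars \<phi> \<subseteq> x \<union> y"

definition fibre ::
    "('s, 'r, 'a) struct \<Rightarrow> ('s, 'r) fm \<Rightarrow> 's var set \<Rightarrow> ('s var \<Rightarrow> 'a) \<Rightarrow> ('s var \<Rightarrow> 'a) set" where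
  "fibre N \<phi> x b = {a \<in> tuples N x. sat N (\<lambda>v. if v \<in> x then a v else b v) \<phi>}"

definition shattered :: "'b set set \<Rightarrow> 'b set \<Rightarrow> bool" where
  "shattered \<G> A \<longleftrightarrow> (\<forall>S \<subseteq> A. \<exists>G \<in> \<G>. G \<inter> A = S)"

definition NIP_fm ::
    "('s, 'r, 'a) struct \<Rightarrow> ('s, 'r) fm \<Rightarrow> 's var set \<Rightarrow> 's var set \<Rightarrow> bool" where
  "NIP_fm N \<phi> x y \<longleftrightarrow>
     (\<exists>n::nat. \<not> (\<exists>A \<subseteq> tuples N x. finite A \<and> card A = n \<and>
        shattered {fibre N \<phi> x b | b. b \<in> tuples N y} A))"

definition has_IP :: "('s, 'r, 'a) struct \<Rightarrow> bool" where
  "has_IP N \<longleftrightarrow> (\<exists>\<phi> x y. partitioned_fm (rank N) \<phi> x y \<and> \<not> NIP_fm N \<phi> x y)"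

datatype mem_sort = Point | Member

datatype mem_rel = Mem

definition mem_struct ::
    "'a set \<Rightarrow> 'a set set \<Rightarrow> (mem_sort, mem_rel, 'a + 'a set) struct" where
  "mem_struct X \<F> =
     \<lparr> rank = (\<lambda>_. [Point, Member]),
       dom_of = (\<lambda>s. case s of Point \<Rightarrow> Inl ` X | Member \<Rightarrow> Inr ` \<F>),
       interp = (\<lambda>_. {[Inl a, Inr A] | a A. a \<in> X \<and> A \<in> \<F> \<and> a \<in> A}) \<rparr>"

end

theory Submission
  imports Defs "HOL-Library.Countable"
begin

text \<open>
  If arbitrarily long tuples of points are shattered by \<open>\<F>\<close>, then membership itself has IP.
  Otherwise every \<open>P \<subseteq> X\<close> whose finite subsets are covered by members of \<open>\<F>\<close> inside \<open>P\<close> has an honest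
  definition of its complement: one formula \<open>\<psi>\<close> has, for each finite \<open>Y \<subseteq> X - P\<close>, an instance \<open>H\<close>
  containing \<open>Y\<close> and disjoint from \<open>P\<close>. As there are only countably many formulas, a single \<open>\<psi>\<close> works
  for cofinally many such \<open>P\<close> of size at most \<open>\<kappa>\<close>.

  The formula with IP says that \<open>F\<close> meets \<open>C \<inter> H\<close>, for \<open>F, C \<in> \<F>\<close> and \<open>H\<close> an instance of \<open>\<psi>\<close>. Let \<open>W\<close> be the
  union of a chain of sets \<open>P\<close> as above whose length is a regular cardinal \<open>\<lambda> \<le> \<kappa>\<close>. A set \<open>F\<close> of size less
  than \<open>\<lambda>\<close> satisfies \<open>F \<inter> W \<subseteq> P\<close> for some \<open>P\<close> in the chain, and because there are \<open>\<kappa>\<^sup>+\<close> points this \<open>P\<close> can be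
  fixed for large families of sets \<open>F\<close>. With \<open>C \<subseteq> W\<close> and \<open>H \<inter> P = {}\<close> those \<open>F\<close> miss \<open>C \<inter> H\<close>, whereas the sets
  through a point \<open>y \<in> W - P\<close> with \<open>y \<in> C \<inter> H\<close> meet it. Repeating this splits every family obtained so far
  into two large ones, which produces all patterns of hits.
\<close>

section \<open>Uniformly definable families\<close>

lemma finite_free_vars: "finite (free_vars \<phi>)"
  by (induction \<phi>) auto

lemma sat_cong: "(\<And>v. v \<in> free_vars \<phi> \<Longrightarrow> e v = e' v) \<Longrightarrow> sat N e \<phi> = sat N e' \<phi>"
proof (induction \<phi> arbitrary: e e')
  case (Rel r vs)
  then have "map e vs = map e' vs" by simp
  then show ?case by (simp only: sat.simps)
next
  case (Neg \<phi>)
  have "sat N e \<phi> = sat N e' \<phi>" by (rule Neg.IH) (simp add: Neg.prems)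
  then show ?case by simp
next
  case (Conj \<phi> \<psi>)
  have "sat N e \<phi> = sat N e' \<phi>" by (rule Conj.IH(1)) (simp add: Conj.prems)
  moreover have "sat N e \<psi> = sat N e' \<psi>" by (rule Conj.IH(2)) (simp add: Conj.prems)
  ultimately show ?case by simp
next
  case (Exi v \<phi>)
  have "sat N (e(v := a)) \<phi> = sat N (e'(v := a)) \<phi>" for a
    by (rule Exi.IH) (use Exi.prems in auto)
  then show ?case by simp
qed simp_all

text \<open>Bound variables are renamed along with free ones; injectivity of \<open>f\<close> is
  what rules out capture.\<close>

primrec rename :: "('s var \<Rightarrow> 's var) \<Rightarrow> ('s, 'r) fm \<Rightarrow> ('s, 'r) fm" where
  "rename f Bot = Bot"
| "rename f (Eq u v) = Eq (f u) (f v)"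
| "rename f (Rel r vs) = Rel r (map f vs)"
| "rename f (Neg \<phi>) = Neg (rename f \<phi>)"
| "rename f (Conj \<phi> \<psi>) = Conj (rename f \<phi>) (rename f \<psi>)"
| "rename f (Exi v \<phi>) = Exi (f v) (rename f \<phi>)"

lemma well_sorted_rename:
  assumes "\<And>v. fst (f v) = fst v"
  shows "well_sorted ar (rename f \<phi>) = well_sorted ar \<phi>"
  using assms by (induction \<phi>) (auto simp: comp_def)

lemma sat_rename:
  assumes "inj f" "\<And>v. fst (f v) = fst v"
  shows "sat N e (rename f \<phi>) = sat N (e \<circ> f) \<phi>"
proof (induction \<phi> arbitrary: e)
  case (Exi v \<phi>)
  have "(e(f v := a)) \<circ> f = (e \<circ> f)(v := a)" for a
    using assms(1) by (auto simp: fun_eq_iff inj_eq)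
  then show ?case by (simp only: rename.simps sat.simps Exi.IH assms(2))
qed (auto simp: comp_def)

definition conjs :: "('s, 'r) fm list \<Rightarrow> ('s, 'r) fm" where
  "conjs \<phi>s = foldr Conj \<phi>s (Neg Bot)"

lemma sat_conjs: "sat N e (conjs \<phi>s) \<longleftrightarrow> (\<forall>\<phi>\<in>set \<phi>s. sat N e \<phi>)"
  by (induction \<phi>s) (auto simp: conjs_def)

lemma well_sorted_conjs: "well_sorted ar (conjs \<phi>s) \<longleftrightarrow> (\<forall>\<phi>\<in>set \<phi>s. well_sorted ar \<phi>)"
  by (induction \<phi>s) (auto simp: conjs_def)

text \<open>Countability of the type of formulas allows one formula to be selected for cofinally
  many sets.\<close>

instance mem_sort :: countable by countable_datatype
instance mem_rel :: countable by countable_datatype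
instance fm :: (countable, countable) countable by countable_datatype

section \<open>Definable subsets of \<open>X\<close>: \<open>pt\<close> is the object variable, all
  others are parameters\<close>

abbreviation pt :: "mem_sort var" where "pt \<equiv> (Point, 0)"

text \<open>Assignments are total, which saves bookkeeping of parameters; finite tuples are cut out
  of them only when IP is derived.\<close>

definition assigns :: "('s, 'r, 'a) struct \<Rightarrow> ('s var \<Rightarrow> 'a) set" where
  "assigns N = {e. \<forall>v. e v \<in> dom_of N (fst v)}"

locale cofinal_family =
  fixes X :: "'a set" and \<F> :: "'a set set"
  assumes subset_X: "A \<in> \<F> \<Longrightarrow> A \<subseteq> X"
    and cofinal: "B \<subseteq> X \<Longrightarrow> finite B \<Longrightarrow> \<exists>A\<in>\<F>. B \<subseteq> A"
    and infinite_X: "infinite X"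
begin

abbreviation "N \<equiv> mem_struct X \<F>"

definition solutions :: "(mem_sort, mem_rel) fm \<Rightarrow> (mem_sort var \<Rightarrow> 'a + 'a set) \<Rightarrow> 'a set" where
  "solutions \<psi> e = {x \<in> X. sat N (e(pt := Inl x)) \<psi>}"

definition instances :: "(mem_sort, mem_rel) fm \<Rightarrow> 'a set set" where
  "instances \<psi> = solutions \<psi> ` assigns N"

definition unif_definable :: "'a set set \<Rightarrow> bool" where
  "unif_definable \<H> \<longleftrightarrow> (\<exists>\<psi>. well_sorted (rank N) \<psi> \<and> \<H> \<subseteq> instances \<psi>)"

lemma dom_of_Point [simp]: "dom_of N Point = Inl ` X"
  and dom_of_Member [simp]: "dom_of N Member = Inr ` \<F>"
  and rank_N [simp]: "rank N = (\<lambda>_. [Point, Member])"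
  by (auto simp: mem_struct_def)

lemma interp_N [simp]: "[Inl a, Inr A] \<in> interp N r \<longleftrightarrow> a \<in> X \<and> A \<in> \<F> \<and> a \<in> A"
  by (auto simp: mem_struct_def)

lemma family_nonempty: "\<F> \<noteq> {}"
  using cofinal[of "{}"] by auto

lemma unif_definableI:
  assumes "well_sorted (rank N) \<psi>" "\<And>H. H \<in> \<H> \<Longrightarrow> \<exists>e\<in>assigns N. H = solutions \<psi> e"
  shows "unif_definable \<H>"
  using assms unfolding unif_definable_def instances_def by blast

lemma unif_definable_subset: "unif_definable \<H> \<Longrightarrow> \<G> \<subseteq> \<H> \<Longrightarrow> unif_definable \<G>"
  unfolding unif_definable_def by blast

lemma unif_definable_Compl:
  assumes "unif_definable \<H>"
  shows "unif_definable {X - H | H. H \<in> \<H>}"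
proof -
  from assms obtain \<psi> where \<psi>: "well_sorted (rank N) \<psi>" "\<H> \<subseteq> instances \<psi>"
    unfolding unif_definable_def by blast
  show ?thesis
  proof (rule unif_definableI)
    show "well_sorted (rank N) (Neg \<psi>)" using \<psi> by simp
    show "\<exists>e\<in>assigns N. A = solutions (Neg \<psi>) e" if A: "A \<in> {X - H | H. H \<in> \<H>}" for A
    proof -
      from A \<psi>(2) obtain e where "e \<in> assigns N" "A = X - solutions \<psi> e"
        unfolding instances_def by blast
      then show ?thesis unfolding solutions_def by auto
    qed
  qed
qed

lemma unif_definable_Int:
  assumes "unif_definable \<H>" "unif_definable \<H>'"
  shows "unif_definable {H \<inter> H' | H H'. H \<in> \<H> \<and> H' \<in> \<H>'}"
proof -
  from assms obtain \<psi> \<psi>' where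
    \<psi>: "well_sorted (rank N) \<psi>" "\<H> \<subseteq> instances \<psi>" and
    \<psi>': "well_sorted (rank N) \<psi>'" "\<H>' \<subseteq> instances \<psi>'"
    unfolding unif_definable_def by blast
  \<comment> \<open>The renamings share only the variable \<open>pt\<close>: \<open>f\<close> uses
    even indices and fixes \<open>pt\<close>, whose index is 0, while \<open>g\<close> uses odd
    indices except at \<open>pt\<close>. One assignment can thus carry both sets of
    parameters.\<close>
  define f :: "mem_sort var \<Rightarrow> mem_sort var" where "f = (\<lambda>(s, i). (s, 2 * i))"
  define g :: "mem_sort var \<Rightarrow> mem_sort var" where
    "g = (\<lambda>v. if v = pt then pt else (fst v, 2 * snd v + 1))"
  have f: "inj f" "\<And>v. fst (f v) = fst v"
    by (auto simp: f_def inj_on_def)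
  have g: "inj g" "\<And>v. fst (g v) = fst v"
    by (auto simp: g_def inj_on_def split: if_splits)
  show ?thesis
  proof (rule unif_definableI)
    show "well_sorted (rank N) (Conj (rename f \<psi>) (rename g \<psi>'))"
      using \<psi>(1) \<psi>'(1) f(2) g(2) by (simp add: well_sorted_rename)
    show "\<exists>e\<in>assigns N. A = solutions (Conj (rename f \<psi>) (rename g \<psi>')) e"
      if "A \<in> {H \<inter> H' | H H'. H \<in> \<H> \<and> H' \<in> \<H>'}" for A
    proof -
      from that \<psi>(2) \<psi>'(2) obtain e e' where e: "e \<in> assigns N" "e' \<in> assigns N"
        and A: "A = solutions \<psi> e \<inter> solutions \<psi>' e'"
        unfolding instances_def by blast
      define e'' where
        "e'' = (\<lambda>(s, j). if even j then e (s, j div 2) else e' (s, j div 2))"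
      have "e'' \<in> assigns N" using e by (auto simp: assigns_def e''_def)
      moreover have "(e''(pt := z)) \<circ> f = e(pt := z)" for z
        by (auto simp: fun_eq_iff f_def e''_def)
      moreover have "(e''(pt := z)) \<circ> g = e'(pt := z)" for z
        by (auto simp: fun_eq_iff g_def e''_def)
      ultimately show ?thesis
        by (intro bexI[of _ e'']) (auto simp: A solutions_def sat_rename[OF f] sat_rename[OF g])
    qed
  qed
qed

text \<open>De Morgan, with complements taken in \<open>X\<close>; hence the members have to be
  subsets of \<open>X\<close>.\<close>

lemma unif_definable_Un:
  assumes "unif_definable \<H>" "unif_definable \<H>'"
    and "\<And>H. H \<in> \<H> \<Longrightarrow> H \<subseteq> X" "\<And>H. H \<in> \<H>' \<Longrightarrow> H \<subseteq> X"
  shows "unif_definable {H \<union> H' | H H'. H \<in> \<H> \<and> H' \<in> \<H>'}"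
proof (rule unif_definable_subset)
  let ?C = "\<lambda>\<H>. {X - H | H. H \<in> \<H>}"
  show "unif_definable (?C {H \<inter> H' | H H'. H \<in> ?C \<H> \<and> H' \<in> ?C \<H>'})"
    by (intro unif_definable_Compl unif_definable_Int assms)
  show "{H \<union> H' | H H'. H \<in> \<H> \<and> H' \<in> \<H>'} \<subseteq> ?C {H \<inter> H' | H H'. H \<in> ?C \<H> \<and> H' \<in> ?C \<H>'}"
  proof clarify
    fix H H' assume H: "H \<in> \<H>" "H' \<in> \<H>'"
    then have "H \<union> H' = X - ((X - H) \<inter> (X - H'))"
      using assms(3,4) by blast
    with H show "\<exists>K. H \<union> H' = X - K \<and> K \<in> {H \<inter> H' | H H'. H \<in> ?C \<H> \<and> H' \<in> ?C \<H>'}"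
      by blast
  qed
qed

lemma assigns_nonempty: obtains e where "e \<in> assigns N"
proof -
  obtain a A where "a \<in> X" "A \<in> \<F>" using infinite_X family_nonempty by fastforce
  then have "(\<lambda>(s, i). case s of Point \<Rightarrow> Inl a | Member \<Rightarrow> Inr A) \<in> assigns N"
    by (auto simp: assigns_def split: mem_sort.split)
  then show ?thesis using that by blast
qed

lemma assigns_upd: "e \<in> assigns N \<Longrightarrow> a \<in> dom_of N (fst v) \<Longrightarrow> e(v := a) \<in> assigns N"
  by (auto simp: assigns_def)

lemma unif_definable_X: "unif_definable {X}"
proof (rule unif_definableI)
  obtain e where "e \<in> assigns N" by (rule assigns_nonempty)
  then show "\<exists>e\<in>assigns N. H = solutions (Neg Bot) e" if "H \<in> {X}" for H
    using that by (auto simp: solutions_def)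
qed simp

lemma unif_definable_family: "unif_definable \<F>"
proof (rule unif_definableI)
  obtain e where e: "e \<in> assigns N" by (rule assigns_nonempty)
  show "\<exists>e\<in>assigns N. H = solutions (Rel Mem [pt, (Member, 0)]) e" if "H \<in> \<F>" for H
    using that subset_X[OF that]
    by (intro bexI[of _ "e((Member, 0) := Inr H)"] assigns_upd e) (auto simp: solutions_def)
qed simp

lemma unif_definable_singletons: "unif_definable {{x} | x. x \<in> X}"
proof (rule unif_definableI)
  obtain e where e: "e \<in> assigns N" by (rule assigns_nonempty)
  fix H assume "H \<in> {{x} | x. x \<in> X}"
  then obtain x where "H = {x}" "x \<in> X" by blast
  then show "\<exists>e\<in>assigns N. H = solutions (Eq pt (Point, 1)) e"
    by (intro bexI[of _ "e((Point, 1) := Inl x)"] assigns_upd e) (auto simp: solutions_def)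
qed simp

text \<open>The sides are exchanged: the parameters of the sets \<open>K i\<close> become the object
  tuples to be shattered, and the single parameter of \<open>\<phi>\<close> is the set
  \<open>F\<close> that hits or misses them.\<close>

lemma has_IP_if_hits_independent:
  assumes "unif_definable \<K>"
    and indep: "\<And>n::nat. \<exists>K. (\<forall>i<n. K i \<in> \<K>) \<and>
      (\<forall>S\<subseteq>{..<n}. \<exists>F\<in>\<F>. \<forall>i<n. F \<inter> K i \<noteq> {} \<longleftrightarrow> i \<in> S)"
  shows "has_IP N"
proof -
  from assms obtain \<psi> where \<psi>: "well_sorted (rank N) \<psi>" "\<K> \<subseteq> instances \<psi>"
    unfolding unif_definable_def by blast
  \<comment> \<open>A fresh variable for \<open>F\<close>, which cannot collide with a parameter of
    \<open>\<psi>\<close>.\<close>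
  obtain k where k: "(Member, k) \<notin> free_vars \<psi>"
  proof -
    have "finite {k. (Member, k) \<in> free_vars \<psi>}"
      using finite_vimageI[OF finite_free_vars[of \<psi>], of "Pair Member"]
      by (simp add: inj_on_def vimage_def)
    then show ?thesis using that ex_new_if_finite[OF infinite_UNIV_nat] by blast
  qed
  define \<phi> where "\<phi> = Exi pt (Conj (Rel Mem [pt, (Member, k)]) \<psi>)"
  define x where "x = free_vars \<psi> - {pt}"
  define y where "y = {(Member, k)}"
  have "partitioned_fm (rank N) \<phi> x y"
    using \<psi>(1) k finite_free_vars[of \<psi>]
    by (auto simp: partitioned_fm_def \<phi>_def x_def y_def)
  moreover have "\<exists>A\<subseteq>tuples N x. finite A \<and> card A = n \<and>
      shattered {fibre N \<phi> x b | b. b \<in> tuples N y} A" for n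
  proof -
    from indep[of n] obtain K where K: "\<And>i. i < n \<Longrightarrow> K i \<in> \<K>"
      and pat: "\<And>S. S \<subseteq> {..<n} \<Longrightarrow> \<exists>F\<in>\<F>. \<forall>i<n. F \<inter> K i \<noteq> {} \<longleftrightarrow> i \<in> S"
      by blast
    have "\<exists>e\<in>assigns N. K i = solutions \<psi> e" if "i < n" for i
      using K[OF that] \<psi>(2) unfolding instances_def by blast
    then obtain e where e: "\<And>i. i < n \<Longrightarrow> e i \<in> assigns N" "\<And>i. i < n \<Longrightarrow> K i = solutions \<psi> (e i)"
      by metis
    define a where "a i = restrict (e i) x" for i
    define b where "b F = (\<lambda>v\<in>y. Inr F :: 'a + 'a set)" for F
    have a: "a i \<in> tuples N x" if "i < n" for i
      using e(1)[OF that] by (auto simp: tuples_def a_def assigns_def)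
    have b: "b F \<in> tuples N y" if "F \<in> \<F>" for F
      using that by (auto simp: tuples_def b_def y_def)
    have fib: "a i \<in> fibre N \<phi> x (b F) \<longleftrightarrow> F \<inter> K i \<noteq> {}" if i: "i < n" and F: "F \<in> \<F>" for i F
    proof -
      let ?e = "\<lambda>v. if v \<in> x then a i v else b F v"
      have "sat N (?e(pt := Inl z)) \<psi> = sat N ((e i)(pt := Inl z)) \<psi>" for z
        by (rule sat_cong) (auto simp: a_def x_def)
      moreover have "?e (Member, k) = Inr F" using k by (auto simp: x_def b_def y_def)
      ultimately have "sat N ?e \<phi> \<longleftrightarrow> (\<exists>z\<in>X. z \<in> F \<and> sat N ((e i)(pt := Inl z)) \<psi>)"
        using F by (auto simp: \<phi>_def)
      also have "\<dots> \<longleftrightarrow> F \<inter> K i \<noteq> {}"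
        unfolding e(2)[OF i] solutions_def by blast
      finally show ?thesis using a[OF i] unfolding fibre_def by simp
    qed
    \<comment> \<open>A set \<open>F\<close> that hits only \<open>K i\<close> tells
      \<open>a i\<close> apart from every other \<open>a j\<close>, so the shattered set really has
      \<open>n\<close> elements.\<close>
    have "inj_on a {..<n}"
    proof (rule inj_onI)
      fix i j assume ij: "i \<in> {..<n}" "j \<in> {..<n}" "a i = a j"
      from pat[of "{i}"] ij obtain F where "F \<in> \<F>" "\<forall>l<n. F \<inter> K l \<noteq> {} \<longleftrightarrow> l \<in> {i}" by auto
      then show "i = j" using ij fib by (metis lessThan_iff singletonD singletonI)
    qed
    then have "card (a ` {..<n}) = n" by (simp add: card_image)
    moreover have "shattered {fibre N \<phi> x b | b. b \<in> tuples N y} (a ` {..<n})"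
      unfolding shattered_def
    proof (intro allI impI)
      fix S assume S: "S \<subseteq> a ` {..<n}"
      from pat[of "{i. i < n \<and> a i \<in> S}"] obtain F where F: "F \<in> \<F>"
        "\<And>i. i < n \<Longrightarrow> F \<inter> K i \<noteq> {} \<longleftrightarrow> a i \<in> S" by auto
      have "a i \<in> fibre N \<phi> x (b F) \<longleftrightarrow> a i \<in> S" if "i < n" for i
        using fib[OF that F(1)] F(2)[OF that] by simp
      then have "fibre N \<phi> x (b F) \<inter> a ` {..<n} = S" using S by blast
      then show "\<exists>G\<in>{fibre N \<phi> x b | b. b \<in> tuples N y}. G \<inter> a ` {..<n} = S"
        using b F(1) by blast
    qed
    moreover have "a ` {..<n} \<subseteq> tuples N x" using a by blast
    ultimately show ?thesis by (intro exI[of _ "a ` {..<n}"] conjI) simp_all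
  qed
  then have "\<not> NIP_fm N \<phi> x y" unfolding NIP_fm_def by simp
  ultimately show ?thesis unfolding has_IP_def by blast
qed

end

section \<open>Ultrafilters\<close>

locale ultra =
  fixes U :: "'a filter"
  assumes proper: "U \<noteq> bot"
    and ultra: "eventually P U \<or> eventually (\<lambda>x. \<not> P x) U"

text \<open>Zorn's lemma for the collections \<open>ev G\<close>, whose inclusion reverses the order
  on filters. A chain is bounded through its infimum, which is proper because whatever holds
  eventually there does so already in some member.\<close>

lemma ultrafilter_below:
  fixes F :: "'a filter"
  assumes "F \<noteq> bot"
  shows "\<exists>U\<le>F. ultra U"
proof -
  define ev :: "'a filter \<Rightarrow> ('a \<Rightarrow> bool) set" where "ev G = {P. eventually P G}" for G
  have ev_mono: "ev G \<subseteq> ev H \<longleftrightarrow> H \<le> G" for G H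
    by (auto simp: ev_def le_filter_def)
  let ?A = "ev ` {G. G \<noteq> bot \<and> G \<le> F}"
  have "\<exists>M\<in>?A. \<forall>E\<in>?A. M \<subseteq> E \<longrightarrow> E = M"
  proof (rule subset_Zorn_nonempty)
    show "?A \<noteq> {}" using assms by auto
    fix C assume "C \<noteq> {}" and C: "subset.chain ?A C"
    define B where "B = {G. G \<noteq> bot \<and> G \<le> F \<and> ev G \<in> C}"
    have C_eq: "C = ev ` B" using C by (auto simp: subset.chain_def B_def)
    have "B \<noteq> {}" using C_eq \<open>C \<noteq> {}\<close> by auto
    have directed: "\<exists>H\<in>B. H \<le> inf G G'" if "G \<in> B" "G' \<in> B" for G G'
    proof -
      have "ev G \<subseteq> ev G' \<or> ev G' \<subseteq> ev G"
        using subset_chain_def[of ?A C] C that by (force simp: B_def)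
      then show ?thesis using that by (auto simp: ev_mono)
    qed
    have ev_Inf: "eventually P (Inf B) \<longleftrightarrow> (\<exists>G\<in>B. eventually P G)" for P
      using eventually_Inf_base[OF \<open>B \<noteq> {}\<close> directed] by blast
    have "Inf B \<noteq> bot"
      using ev_Inf[of "\<lambda>_. False"] by (auto simp: B_def trivial_limit_def)
    moreover obtain G where "G \<in> B" using \<open>B \<noteq> {}\<close> by blast
    then have "Inf B \<le> F" using Inf_lower[of G B] by (auto simp: B_def)
    moreover have "\<Union>C = ev (Inf B)" using ev_Inf by (auto simp: C_eq ev_def)
    ultimately show "\<Union>C \<in> ?A" by blast
  qed
  then obtain U where U: "U \<noteq> bot" "U \<le> F"
    and max: "\<And>G. G \<noteq> bot \<Longrightarrow> G \<le> F \<Longrightarrow> G \<le> U \<Longrightarrow> ev G = ev U"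
    by (auto simp: ev_mono)
  have "eventually P U \<or> eventually (\<lambda>x. \<not> P x) U" for P
  proof (rule disjCI)
    assume "\<not> eventually (\<lambda>x. \<not> P x) U"
    \<comment> \<open>Refining \<open>U\<close> by the set where \<open>P\<close> holds gives a
      proper filter, which maximality identifies with \<open>U\<close>.\<close>
    then have "inf U (principal {x. P x}) \<noteq> bot"
      by (simp add: trivial_limit_def eventually_inf_principal)
    then have "ev (inf U (principal {x. P x})) = ev U"
      using U(2) by (intro max) (auto intro: le_infI1)
    moreover have "P \<in> ev (inf U (principal {x. P x}))" by (auto simp: ev_def eventually_inf_principal)
    ultimately show "eventually P U" by (simp add: ev_def)
  qed
  then show ?thesis using U by (auto simp: ultra_def)
qed

text \<open>The properties whose exceptions in \<open>Z\<close> lie in \<open>\<I>\<close> form a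
  filter, proper because \<open>Z \<notin> \<I>\<close>; any ultrafilter below it works.\<close>

lemma ultrafilter_avoiding_ideal:
  assumes "{} \<in> \<I>" "\<And>A B. A \<in> \<I> \<Longrightarrow> B \<in> \<I> \<Longrightarrow> A \<union> B \<in> \<I>"
    "\<And>A B. A \<in> \<I> \<Longrightarrow> B \<subseteq> A \<Longrightarrow> B \<in> \<I>" "Z \<notin> \<I>"
  shows "\<exists>U. ultra U \<and> eventually (\<lambda>x. x \<in> Z) U \<and> (\<forall>A\<in>\<I>. eventually (\<lambda>x. x \<notin> A) U)"
proof -
  define G where "G = Abs_filter (\<lambda>P. {x\<in>Z. \<not> P x} \<in> \<I>)"
  have "is_filter (\<lambda>P. {x\<in>Z. \<not> P x} \<in> \<I>)"
  proof
    show "{x\<in>Z. \<not> (P x \<and> Q x)} \<in> \<I>" if "{x\<in>Z. \<not> P x} \<in> \<I>" "{x\<in>Z. \<not> Q x} \<in> \<I>" for P Q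
      by (rule assms(3)[OF assms(2)[OF that]]) auto
    show "{x\<in>Z. \<not> Q x} \<in> \<I>" if "\<forall>x. P x \<longrightarrow> Q x" "{x\<in>Z. \<not> P x} \<in> \<I>" for P Q
      by (rule assms(3)[OF that(2)]) (use that(1) in auto)
  qed (simp add: assms(1))
  then have ev: "eventually P G \<longleftrightarrow> {x\<in>Z. \<not> P x} \<in> \<I>" for P
    unfolding G_def by (rule eventually_Abs_filter)
  have "G \<noteq> bot" using assms(4) by (simp add: trivial_limit_def ev)
  then obtain U where U: "U \<le> G" "ultra U"
    using ultrafilter_below by blast
  have "eventually (\<lambda>x. x \<in> Z) G" using assms(1) by (simp add: ev)
  moreover have "eventually (\<lambda>x. x \<notin> A) G" if "A \<in> \<I>" for A
    unfolding ev by (rule assms(3)[OF that]) auto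
  ultimately show ?thesis using U by (meson filter_leD)
qed

section \<open>Generic tuples for an ultrafilter\<close>

context ultra
begin

lemma eventually_iff: "eventually (\<lambda>x. P x \<longleftrightarrow> eventually P U) U"
proof (cases "eventually P U")
  case False
  then show ?thesis using ultra[of P] by simp
qed simp

text \<open>
  \<open>U\<close>-generic tuples are chosen from the last coordinate to the first, so the head of a list of
  signs belongs to the last coordinate.
\<close>

primrec generic :: "bool list \<Rightarrow> 'a set set \<Rightarrow> bool" where
  "generic [] \<E> \<longleftrightarrow> \<E> \<noteq> {}"
| "generic (c # cs) \<E> \<longleftrightarrow> eventually (\<lambda>x. generic cs {F \<in> \<E>. x \<in> F \<longleftrightarrow> c}) U"

lemma generic_mono: "generic cs \<E> \<Longrightarrow> \<E> \<subseteq> \<E>' \<Longrightarrow> generic cs \<E>'"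
proof (induction cs arbitrary: \<E> \<E>')
  case (Cons c cs)
  have "generic cs {F \<in> \<E>'. x \<in> F \<longleftrightarrow> c}" if "generic cs {F \<in> \<E>. x \<in> F \<longleftrightarrow> c}" for x
    by (rule Cons.IH[OF that]) (use Cons.prems(2) in blast)
  then show ?case using Cons.prems(1) by (auto elim: eventually_mono)
qed auto

primrec alternating :: "nat \<Rightarrow> bool list" where
  "alternating 0 = []"
| "alternating (Suc r) = odd r # alternating r"

text \<open>Each block of two consecutive variables is thinned out to the one of the required sign.\<close>

lemma generic_if_alternating:
  "generic (alternating (2 * length cs)) \<E> \<Longrightarrow> generic cs \<E>"
proof (induction cs arbitrary: \<E>)
  case (Cons c cs)
  let ?r = "2 * length cs"
  have *: "eventually (\<lambda>x. eventually (\<lambda>y.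
      generic (alternating ?r) {F \<in> {F \<in> \<E>. x \<in> F}. y \<notin> F}) U) U"
    using Cons.prems by simp
  show ?case
  proof (cases c)
    case True
    have "generic cs {F \<in> \<E>. x \<in> F}"
      if ev: "eventually (\<lambda>y. generic (alternating ?r) {F \<in> {F \<in> \<E>. x \<in> F}. y \<notin> F}) U" for x
    proof -
      obtain y where "generic (alternating ?r) {F \<in> {F \<in> \<E>. x \<in> F}. y \<notin> F}"
        using eventually_happens'[OF proper ev] by blast
      then show ?thesis by (intro Cons.IH) (erule generic_mono, blast)
    qed
    then show ?thesis using * True by (auto elim: eventually_mono)
  next
    case False
    \<comment> \<open>Here one good \<open>x\<close> is fixed and the second variable of the block
      survives.\<close>
    obtain x where "eventually (\<lambda>y. generic (alternating ?r) {F \<in> {F \<in> \<E>. x \<in> F}. y \<notin> F}) U"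
      using eventually_happens'[OF proper *] by blast
    then have "eventually (\<lambda>y. generic cs {F \<in> \<E>. y \<notin> F}) U"
      by (rule eventually_mono) (intro Cons.IH, erule generic_mono, blast)
    then show ?thesis using False by simp
  qed
qed simp

text \<open>Finitely many eventual conditions hold at a common point \<open>x\<close>. A finite set
  of families is treated at once because choosing \<open>x\<close> replaces each family by its two
  parts, according to whether \<open>x\<close> is a member.\<close>

lemma all_patterns_if_generic:
  assumes "eventually (\<lambda>x. x \<in> X) U" "finite \<C>"
    and "\<And>\<E> cs. \<E> \<in> \<C> \<Longrightarrow> length cs = d \<Longrightarrow> generic cs \<E>"
  shows "\<exists>xs. length xs = d \<and> set xs \<subseteq> X \<and>
    (\<forall>\<E>\<in>\<C>. \<forall>cs. length cs = d \<longrightarrow> (\<exists>F\<in>\<E>. \<forall>i<d. xs ! i \<in> F \<longleftrightarrow> cs ! i))"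
  using assms(2,3)
proof (induction d arbitrary: \<C>)
  case 0
  then show ?case by auto
next
  case (Suc d)
  have fin: "finite {cs :: bool list. length cs = d}"
    using finite_lists_length_eq[of "UNIV :: bool set" d] by simp
  have "eventually (\<lambda>x. x \<in> X \<and> (\<forall>\<E>\<in>\<C>. \<forall>c\<in>UNIV. \<forall>cs\<in>{cs. length cs = d}.
      generic cs {F \<in> \<E>. x \<in> F \<longleftrightarrow> c})) U"
    by (intro eventually_conj assms(1) eventually_ball_finite Suc.prems(1) ballI fin finite)
      (use Suc.prems(2)[of _ "_ # _"] in simp)
  from eventually_happens'[OF proper this] obtain x where x: "x \<in> X"
    and gen: "\<And>\<E> c cs. \<E> \<in> \<C> \<Longrightarrow> length cs = d \<Longrightarrow> generic cs {F \<in> \<E>. x \<in> F \<longleftrightarrow> c}"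
    by blast
  let ?C = "(\<lambda>(\<E>, c). {F \<in> \<E>. x \<in> F \<longleftrightarrow> c}) ` (\<C> \<times> UNIV)"
  have "\<exists>xs. length xs = d \<and> set xs \<subseteq> X \<and>
    (\<forall>\<E>\<in>?C. \<forall>cs. length cs = d \<longrightarrow> (\<exists>F\<in>\<E>. \<forall>i<d. xs ! i \<in> F \<longleftrightarrow> cs ! i))"
    by (rule Suc.IH) (use Suc.prems(1) gen in auto)
  then obtain xs where xs: "length xs = d" "set xs \<subseteq> X"
    and pat: "\<And>\<E> c cs. \<E> \<in> \<C> \<Longrightarrow> length cs = d \<Longrightarrow>
      \<exists>F\<in>{F \<in> \<E>. x \<in> F \<longleftrightarrow> c}. \<forall>i<d. xs ! i \<in> F \<longleftrightarrow> cs ! i"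
    by (auto simp: split_beta)
  have "\<exists>F\<in>\<E>. \<forall>i<Suc d. (x # xs) ! i \<in> F \<longleftrightarrow> cs ! i" if "\<E> \<in> \<C>" "length cs = Suc d" for \<E> cs
  proof -
    obtain c cs' where cs: "cs = c # cs'" "length cs' = d"
      using \<open>length cs = Suc d\<close> by (auto simp: length_Suc_conv)
    from pat[OF \<open>\<E> \<in> \<C>\<close> cs(2), of c] show ?thesis
      by (auto simp: cs(1) nth_Cons split: nat.splits)
  qed
  then show ?case using xs x by (intro exI[of _ "x # xs"]) auto
qed

end

section \<open>Honest definitions\<close>

context cofinal_family
begin

text \<open>The number \<open>r\<close> is an offset: \<open>ys\<close> occupies the positions from
  \<open>r\<close> on in a longer sequence whose odd positions are those inside
  \<open>F\<close>.\<close>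

definition alt_class :: "nat \<Rightarrow> 'a list \<Rightarrow> 'a set set" where
  "alt_class r ys = {F \<in> \<F>. \<forall>i<length ys. ys ! i \<in> F \<longleftrightarrow> odd (r + i)}"

text \<open>Turns one recursion step of \<open>generic\<close> along \<open>alternating\<close> into
  prepending a point at position \<open>r\<close>.\<close>

lemma alt_class_Cons:
  "alt_class r (x # ys) = {F \<in> alt_class (Suc r) ys. x \<in> F \<longleftrightarrow> odd r}"
  by (auto simp: alt_class_def All_less_Suc2)

lemma unif_definable_alt_class:
  "unif_definable {{x \<in> X. alt_class 0 (bs @ x # ys) \<noteq> {}} | bs ys.
     bs \<in> lists X \<and> length bs = r \<and> ys \<in> lists X \<and> length ys = m}"
    (is "unif_definable ?\<H>")
proof -
  \<comment> \<open>Position \<open>r\<close> is held by \<open>pt\<close>, which has index 0; any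
    other position \<open>j\<close> is a parameter with the shifted index
    \<open>Suc j\<close>.\<close>
  define L :: "nat \<Rightarrow> (mem_sort, mem_rel) fm"
    where "L j = Rel Mem [(Point, if j = r then 0 else Suc j), (Member, 0)]" for j
  define lit where "lit j = (if odd j then L j else Neg (L j))" for j
  define \<psi> where "\<psi> = Exi (Member, 0) (conjs (map lit [0..<Suc (r + m)]))"
  show ?thesis
  proof (rule unif_definableI)
    show "well_sorted (rank N) \<psi>"
      by (auto simp: \<psi>_def well_sorted_conjs lit_def L_def)
    fix H assume "H \<in> ?\<H>"
    then obtain bs ys where H: "H = {x \<in> X. alt_class 0 (bs @ x # ys) \<noteq> {}}"
      and bs: "bs \<in> lists X" "length bs = r" and ys: "ys \<in> lists X" "length ys = m"
      by blast
    obtain e where e: "e \<in> assigns N" by (rule assigns_nonempty)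
    \<comment> \<open>A filler for position \<open>r\<close>: the parameter variable of that
      position does not occur in \<open>\<psi>\<close>.\<close>
    obtain a where a: "a \<in> X" using infinite_X by fastforce
    let ?zs = "bs @ a # ys"
    have zs: "?zs ! j \<in> X" if "j < Suc (r + m)" for j
      using that a bs ys nth_mem[of j ?zs] by auto
    define e' where
      "e' v = (if fst v = Point \<and> 0 < snd v \<and> snd v \<le> Suc (r + m)
        then Inl (?zs ! (snd v - 1)) else e v)" for v
    have "e' \<in> assigns N"
      using e zs by (auto simp: assigns_def e'_def)
    moreover have "sat N (e'(pt := Inl x)) \<psi> \<longleftrightarrow> alt_class 0 (bs @ x # ys) \<noteq> {}" if x: "x \<in> X" for x
    proof -
      let ?xs = "bs @ x # ys"
      have "sat N ((e'(pt := Inl x))((Member, 0) := Inr F)) (lit j) \<longleftrightarrow> (?xs ! j \<in> F \<longleftrightarrow> odd j)"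
        if "F \<in> \<F>" "j < Suc (r + m)" for F j
        using that x zs[of j] bs(2) by (auto simp: lit_def L_def e'_def nth_append nth_Cons')
      then have "sat N (e'(pt := Inl x)) \<psi> \<longleftrightarrow>
          (\<exists>F\<in>\<F>. \<forall>j<Suc (r + m). ?xs ! j \<in> F \<longleftrightarrow> odd j)"
        by (simp add: \<psi>_def sat_conjs del: upt_Suc) (simp add: Ball_def)
      also have "\<dots> \<longleftrightarrow> alt_class 0 ?xs \<noteq> {}"
        using bs(2) ys(2) by (auto simp: alt_class_def)
      finally show ?thesis .
    qed
    ultimately show "\<exists>e\<in>assigns N. H = solutions \<psi> e"
      unfolding H solutions_def by (intro bexI[of _ e']) auto
  qed
qed

text \<open>Each \<open>ys\<close> contributes a class or its complement, as \<open>\<tau>\<close>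
  prescribes. The intersections in the induction have unrelated parameters; the wanted sets are
  those where all parts share one \<open>bs\<close>.\<close>

lemma unif_definable_alt_type:
  assumes "finite L" "L \<subseteq> {ys \<in> lists X. length ys = m}"
  shows "unif_definable {{x \<in> X. \<forall>ys\<in>L. alt_class 0 (bs @ x # ys) \<noteq> {} \<longleftrightarrow> \<tau> ys} | bs.
     bs \<in> lists X \<and> length bs = r}"
  using assms
proof (induction L rule: finite_induct)
  case empty
  show ?case by (rule unif_definable_subset[OF unif_definable_X]) auto
next
  case (insert ys L)
  let ?A = "{{x \<in> X. alt_class 0 (bs @ x # ys) \<noteq> {}} | bs ys.
     bs \<in> lists X \<and> length bs = r \<and> ys \<in> lists X \<and> length ys = m}"
  let ?B = "if \<tau> ys then ?A else {X - H | H. H \<in> ?A}"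
  let ?C = "{{x \<in> X. \<forall>ys\<in>L. alt_class 0 (bs @ x # ys) \<noteq> {} \<longleftrightarrow> \<tau> ys} | bs.
     bs \<in> lists X \<and> length bs = r}"
  have "unif_definable ?B"
    using unif_definable_alt_class[of r m] unif_definable_Compl[OF unif_definable_alt_class[of r m]]
    by (simp only: if_split simp_thms)
  moreover have "unif_definable ?C" using insert by auto
  ultimately have "unif_definable {H \<inter> H' | H H'. H \<in> ?B \<and> H' \<in> ?C}"
    by (rule unif_definable_Int)
  then show ?case
  proof (rule unif_definable_subset, intro subsetI)
    fix A assume "A \<in> {{x \<in> X. \<forall>ys\<in>insert ys L. alt_class 0 (bs @ x # ys) \<noteq> {} \<longleftrightarrow> \<tau> ys} | bs.
      bs \<in> lists X \<and> length bs = r}"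
    then obtain bs where bs: "bs \<in> lists X" "length bs = r"
      and A: "A = {x \<in> X. \<forall>ys\<in>insert ys L. alt_class 0 (bs @ x # ys) \<noteq> {} \<longleftrightarrow> \<tau> ys}" by blast
    let ?H = "{x \<in> X. alt_class 0 (bs @ x # ys) \<noteq> {} \<longleftrightarrow> \<tau> ys}"
    let ?H' = "{x \<in> X. \<forall>ys\<in>L. alt_class 0 (bs @ x # ys) \<noteq> {} \<longleftrightarrow> \<tau> ys}"
    let ?K = "{x \<in> X. alt_class 0 (bs @ x # ys) \<noteq> {}}"
    have "?K \<in> ?A" using bs insert.prems by blast
    moreover have "?H = (if \<tau> ys then ?K else X - ?K)" by auto
    ultimately have "?H \<in> ?B" by (cases "\<tau> ys") auto
    moreover have "?H' \<in> ?C" using bs by blast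
    moreover have "A = ?H \<inter> ?H'" by (auto simp: A)
    ultimately show "A \<in> {H \<inter> H' | H H'. H \<in> ?B \<and> H' \<in> ?C}" by blast
  qed
qed

text \<open>Such a \<open>P\<close> agrees on every finite set with some member of
  \<open>\<F>\<close>, so it is externally definable by membership.\<close>

definition self_covered :: "'a set \<Rightarrow> bool" where
  "self_covered P \<longleftrightarrow> P \<subseteq> X \<and> (\<forall>B\<subseteq>P. finite B \<longrightarrow> (\<exists>F\<in>\<F>. B \<subseteq> F \<and> F \<subseteq> P))"

definition separates :: "(mem_sort, mem_rel) fm \<Rightarrow> 'a set \<Rightarrow> 'a set \<Rightarrow> bool" where
  "separates \<psi> A P \<longleftrightarrow> well_sorted (rank N) \<psi> \<and>
     (\<forall>Y\<subseteq>A. finite Y \<longrightarrow> (\<exists>H\<in>instances \<psi>. Y \<subseteq> H \<and> H \<inter> P = {}))"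

lemma separates_subset: "separates \<psi> A P \<Longrightarrow> B \<subseteq> A \<Longrightarrow> separates \<psi> B P"
  unfolding separates_def by blast

text \<open>The two parts of \<open>Y\<close> are covered separately and the instances united.
  Together with its two neighbours this makes the separated sets, for fixed \<open>P\<close>, an
  ideal.\<close>

lemma separates_Un:
  assumes "separates \<psi> A P" "separates \<psi>' B P"
  shows "\<exists>\<psi>''. separates \<psi>'' (A \<union> B) P"
proof -
  have "unif_definable {H \<union> H' | H H'. H \<in> instances \<psi> \<and> H' \<in> instances \<psi>'}"
    using assms
    by (intro unif_definable_Un) (auto simp: unif_definable_def separates_def instances_def solutions_def)
  then obtain \<psi>'' where \<psi>'': "well_sorted (rank N) \<psi>''"
    "{H \<union> H' | H H'. H \<in> instances \<psi> \<and> H' \<in> instances \<psi>'} \<subseteq> instances \<psi>''"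
    unfolding unif_definable_def by blast
  have "\<exists>H\<in>instances \<psi>''. Y \<subseteq> H \<and> H \<inter> P = {}" if Y: "Y \<subseteq> A \<union> B" "finite Y" for Y
  proof -
    obtain H where H: "H \<in> instances \<psi>" "Y \<inter> A \<subseteq> H" "H \<inter> P = {}"
      using assms(1) Y(2) unfolding separates_def by (meson finite_Int inf_le2)
    obtain H' where H': "H' \<in> instances \<psi>'" "Y \<inter> B \<subseteq> H'" "H' \<inter> P = {}"
      using assms(2) Y(2) unfolding separates_def by (meson finite_Int inf_le2)
    have "H \<union> H' \<in> instances \<psi>''" using \<psi>''(2) H(1) H'(1) by blast
    then show ?thesis using Y(1) H H' by (intro bexI[of _ "H \<union> H'"]) auto
  qed
  then show ?thesis using \<psi>''(1) unfolding separates_def by blast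
qed

lemma separates_empty: "\<exists>\<psi>. separates \<psi> {} P"
proof -
  obtain e where e: "e \<in> assigns N" by (rule assigns_nonempty)
  then have "solutions Bot e \<in> instances Bot" unfolding instances_def by blast
  then have "separates Bot {} P" by (auto simp: separates_def solutions_def)
  then show ?thesis by blast
qed

definition shatters_tuple :: "nat \<Rightarrow> bool" where
  "shatters_tuple d \<longleftrightarrow> (\<exists>xs. length xs = d \<and> set xs \<subseteq> X \<and>
     (\<forall>cs. length cs = d \<longrightarrow> (\<exists>F\<in>\<F>. \<forall>i<d. xs ! i \<in> F \<longleftrightarrow> cs ! i)))"

text \<open>
  The existence of honest definitions: an ultrafilter \<open>U\<close> on \<open>X - P\<close> that avoids all separated sets
  would allow tuples generic for \<open>U\<close> to alternate between \<open>X - P\<close> and \<open>P\<close> arbitrarily often.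
\<close>

lemma self_covered_separated:
  assumes P: "self_covered P" and d: "\<not> shatters_tuple d"
  shows "\<exists>\<psi>. separates \<psi> (X - P) P"
proof (rule ccontr)
  assume nsep: "\<nexists>\<psi>. separates \<psi> (X - P) P"
  define \<I> where "\<I> = {A. \<exists>\<psi>. separates \<psi> A P}"
  have "\<exists>U. ultra U \<and> eventually (\<lambda>x. x \<in> X - P) U \<and> (\<forall>A\<in>\<I>. eventually (\<lambda>x. x \<notin> A) U)"
  proof (rule ultrafilter_avoiding_ideal[of \<I> "X - P"])
    show "{} \<in> \<I>" using separates_empty by (simp add: \<I>_def)
    show "A \<union> B \<in> \<I>" if "A \<in> \<I>" "B \<in> \<I>" for A B
      using that separates_Un by (auto simp: \<I>_def)
    show "B \<in> \<I>" if "A \<in> \<I>" "B \<subseteq> A" for A B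
      using that separates_subset unfolding \<I>_def by blast
    show "X - P \<notin> \<I>" using nsep by (simp add: \<I>_def)
  qed
  then obtain U where "ultra U" and U_X: "eventually (\<lambda>x. x \<in> X - P) U"
    and U_I: "\<And>A. A \<in> \<I> \<Longrightarrow> eventually (\<lambda>x. x \<notin> A) U"
    by blast
  then interpret ultra U by simp
  \<comment> \<open>Thinning spends two alternating points on each of the \<open>d\<close>
    signs.\<close>
  define n where "n = 2 * d"
  \<comment> \<open>The truth value that \<open>U\<close> gives to the statement that some member
    alternates along \<open>r\<close> generic points followed by \<open>ys\<close>.\<close>
  define t where "t r ys = generic (alternating r) (alt_class r ys)" for r ys
  have t_0: "t 0 ys \<longleftrightarrow> alt_class 0 ys \<noteq> {}" for ys by (simp add: t_def)
  have t_Suc: "t (Suc r) ys \<longleftrightarrow> eventually (\<lambda>x. t r (x # ys)) U" for r ys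
    by (simp add: t_def alt_class_Cons)
  \<comment> \<open>Concrete points \<open>bs\<close> replace the \<open>r\<close> generic ones:
    they lie alternately outside and inside \<open>P\<close>, yet over \<open>Y\<close> they give
    the same answers.\<close>
  define realizes where "realizes r bs Y \<longleftrightarrow> bs \<in> lists X \<and> length bs = r \<and>
      (\<forall>i<r. bs ! i \<in> P \<longleftrightarrow> odd i) \<and>
      (\<forall>ys\<in>lists Y. length ys = n - r \<longrightarrow> (alt_class 0 (bs @ ys) \<noteq> {} \<longleftrightarrow> t r ys))" for r bs Y
  have realizable: "\<exists>bs. realizes r bs Y" if "r \<le> n" "Y \<subseteq> X" "finite Y" for r Y
    using that
  proof (induction r arbitrary: Y)
    case 0
    then show ?case by (auto simp: realizes_def t_0)
  next
    case (Suc r)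
    let ?L = "\<lambda>Y. {ys \<in> lists Y. length ys = n - Suc r}"
    have fin: "finite (?L Y)" if "finite Y" for Y :: "'a set"
      using finite_lists_length_eq[OF that, of "n - Suc r"] by (simp add: lists_eq_set)
    have n: "n - r = Suc (n - Suc r)" using Suc.prems(1) by simp
    have ev: "eventually (\<lambda>y. \<forall>ys\<in>?L Y. t r (y # ys) \<longleftrightarrow> t (Suc r) ys) U" if "finite Y" for Y
      unfolding t_Suc by (intro eventually_ball_finite fin that ballI eventually_iff)
    have extend: "realizes (Suc r) (bs @ [y]) Y"
      if bs: "realizes r bs Y'" "Y \<subseteq> Y'" and y: "y \<in> X" "y \<in> P \<longleftrightarrow> odd r"
        and gen: "\<And>ys. ys \<in> ?L Y \<Longrightarrow> alt_class 0 (bs @ y # ys) \<noteq> {} \<longleftrightarrow> t (Suc r) ys" for bs y Y Y'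
      using bs y gen by (auto simp: realizes_def nth_append less_Suc_eq)
    show ?case
    proof (cases "even r")
      case True
      \<comment> \<open>An even position wants a point outside \<open>P\<close>, where
        \<open>U\<close> concentrates, so a generic \<open>y\<close> serves; the earlier points are
        then chosen over \<open>insert y Y\<close>.\<close>
      from eventually_happens'[OF proper eventually_conj[OF U_X ev[OF Suc.prems(3)]]]
      obtain y where y: "y \<in> X - P" "\<And>ys. ys \<in> ?L Y \<Longrightarrow> t r (y # ys) \<longleftrightarrow> t (Suc r) ys" by blast
      obtain bs where bs: "realizes r bs (insert y Y)"
        using Suc y(1) by (metis DiffD1 Suc_leD finite_insert insert_subset)
      have "alt_class 0 (bs @ y # ys) \<noteq> {} \<longleftrightarrow> t (Suc r) ys" if "ys \<in> ?L Y" for ys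
      proof -
        have "y # ys \<in> lists (insert y Y)" using that by auto
        moreover have "length (y # ys) = n - r" using that n by simp
        ultimately have "alt_class 0 (bs @ y # ys) \<noteq> {} \<longleftrightarrow> t r (y # ys)"
          using bs unfolding realizes_def by blast
        then show ?thesis using y(2)[OF that] by simp
      qed
      then show ?thesis using extend[OF bs] y(1) True by blast
    next
      case False
      show ?thesis
      proof (rule ccontr)
        assume none: "\<nexists>bs. realizes (Suc r) bs Y"
        \<comment> \<open>An odd position wants a point of \<open>P\<close>. If none fits, the sets
          \<open>H bs\<close> avoid \<open>P\<close> and cover any finite part of the set
          \<open>A\<close> of typical points; so \<open>A\<close> is separated, although
          \<open>U\<close> concentrates on it.\<close>
        define A where "A = {y \<in> X. \<forall>ys\<in>?L Y. t r (y # ys) \<longleftrightarrow> t (Suc r) ys}"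
        define H where "H bs = {x \<in> X. \<forall>ys\<in>?L Y. alt_class 0 (bs @ x # ys) \<noteq> {} \<longleftrightarrow> t (Suc r) ys}" for bs
        have "unif_definable {H bs | bs. bs \<in> lists X \<and> length bs = r}"
          unfolding H_def using Suc.prems(2)
          by (intro unif_definable_alt_type[of _ "n - Suc r"] fin Suc.prems(3)) auto
        then obtain \<psi> where \<psi>: "well_sorted (rank N) \<psi>"
          "\<And>bs. bs \<in> lists X \<Longrightarrow> length bs = r \<Longrightarrow> H bs \<in> instances \<psi>"
          unfolding unif_definable_def by blast
        have "\<exists>H\<in>instances \<psi>. Z \<subseteq> H \<and> H \<inter> P = {}" if Z: "Z \<subseteq> A" "finite Z" for Z
        proof -
          have "Y \<union> Z \<subseteq> X" using Z(1) Suc.prems(2) by (auto simp: A_def)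
          \<comment> \<open>With \<open>Z\<close> included in the base set, every \<open>z\<close>
            in \<open>Z\<close> behaves over \<open>bs\<close> as \<open>t\<close> predicts.\<close>
          then obtain bs where bs: "realizes r bs (Y \<union> Z)"
            using Suc.IH[of "Y \<union> Z"] Suc.prems(1,3) Z(2) by auto
          have "H bs \<in> instances \<psi>" using bs \<psi>(2) by (simp add: realizes_def)
          moreover have "Z \<subseteq> H bs"
          proof
            fix z assume z: "z \<in> Z"
            have "alt_class 0 (bs @ z # ys) \<noteq> {} \<longleftrightarrow> t (Suc r) ys" if ys: "ys \<in> ?L Y" for ys
            proof -
              have "z # ys \<in> lists (Y \<union> Z)" using ys z by auto
              moreover have "length (z # ys) = n - r" using ys n by simp
              ultimately have "alt_class 0 (bs @ z # ys) \<noteq> {} \<longleftrightarrow> t r (z # ys)"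
                using bs unfolding realizes_def by blast
              then show ?thesis using z Z(1) ys by (auto simp: A_def)
            qed
            then show "z \<in> H bs" using z Z(1) by (auto simp: H_def A_def)
          qed
          moreover have "H bs \<inter> P = {}"
          proof (rule ccontr)
            assume "H bs \<inter> P \<noteq> {}"
            then obtain x where "x \<in> H bs" "x \<in> P" by blast
            then have "realizes (Suc r) (bs @ [x]) Y"
              using False by (intro extend[OF bs]) (auto simp: H_def)
            then show False using none by blast
          qed
          ultimately show ?thesis by blast
        qed
        then have "A \<in> \<I>" using \<psi>(1) unfolding \<I>_def separates_def by blast
        then have "eventually (\<lambda>x. x \<notin> A) U" by (rule U_I)
        moreover have "eventually (\<lambda>x. x \<in> A) U"
          using eventually_conj[OF U_X ev[OF Suc.prems(3)]]
          by (rule eventually_mono) (auto simp: A_def)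
        ultimately have "eventually (\<lambda>x. False) U" by eventually_elim simp
        then show False using proper by simp
      qed
    qed
  qed
  obtain bs where "realizes n bs {}" using realizable by blast
  then have bs: "bs \<in> lists X" "length bs = n" "\<And>i. i < n \<Longrightarrow> bs ! i \<in> P \<longleftrightarrow> odd i"
    and t: "alt_class 0 bs \<noteq> {} \<longleftrightarrow> t n []"
    unfolding realizes_def by auto
  \<comment> \<open>The entries of \<open>bs\<close> in \<open>P\<close> are those at odd positions,
    so \<open>F\<close> picks out exactly these and witnesses the alternating class.\<close>
  obtain F where F: "F \<in> \<F>" "set bs \<inter> P \<subseteq> F" "F \<subseteq> P"
    using P unfolding self_covered_def by (meson List.finite_set finite_Int inf_le2)
  have "bs ! i \<in> F \<longleftrightarrow> bs ! i \<in> P" if "i < n" for i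
    using F(2,3) nth_mem[of i bs] bs(2) that by blast
  then have "F \<in> alt_class 0 bs" using bs F(1) by (simp add: alt_class_def)
  then have "t n []" using t by blast
  then have "generic (alternating (2 * d)) \<F>" by (simp add: t_def n_def alt_class_def)
  then have "generic cs \<F>" if "length cs = d" for cs
    using that generic_if_alternating by blast
  moreover have "eventually (\<lambda>x. x \<in> X) U" using U_X by (rule eventually_mono) simp
  ultimately have "shatters_tuple d"
    unfolding shatters_tuple_def using all_patterns_if_generic[of X "{\<F>}" d] by auto
  then show False using d by blast
qed

end

section \<open>Splitting large families\<close>

locale small_cofinal_family = cofinal_family X \<F> for X :: "'a set" and \<F> :: "'a set set" +
  fixes \<kappa> :: "'k rel"
  assumes \<kappa>: "Cinfinite \<kappa>" and large_X: "cardSuc \<kappa> \<le>o |X|"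
    and small: "A \<in> \<F> \<Longrightarrow> |A| <o \<kappa>"
begin

section \<open>Sets of cardinality at most \<open>\<kappa>\<close>\<close>

lemma small_subset: "|B| \<le>o \<kappa> \<Longrightarrow> A \<subseteq> B \<Longrightarrow> |A| \<le>o \<kappa>"
  by (rule ordLeq_transitive[OF card_of_mono1])

lemma small_UN: "|I| \<le>o \<kappa> \<Longrightarrow> (\<And>i. i \<in> I \<Longrightarrow> |A i| \<le>o \<kappa>) \<Longrightarrow> |\<Union>i\<in>I. A i| \<le>o \<kappa>"
  by (intro UNION_Cinfinite_bound \<kappa> ballI)

lemma small_countable: "|A :: 'b :: countable set| \<le>o \<kappa>"
proof -
  have "|A| \<le>o |UNIV :: nat set|"
    using card_of_ordLeqI[of to_nat A UNIV] by (simp add: inj_on_def)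
  then show ?thesis
    using natLeq_ordLeq_cinfinite[OF \<kappa>] card_of_nat ordLeq_ordIso_trans ordLeq_transitive by blast
qed

lemma small_finite: "finite A \<Longrightarrow> |A| \<le>o \<kappa>"
  by (rule ordLess_imp_ordLeq, rule Cfinite_ordLess_Cinfinite[OF _ \<kappa>])
    (simp add: cfinite_def Field_card_of card_of_card_order_on)

lemma not_small_X: "\<not> |X| \<le>o \<kappa>"
proof
  assume "|X| \<le>o \<kappa>"
  then have "cardSuc \<kappa> \<le>o \<kappa>" using large_X ordLeq_transitive by blast
  then show False using cardSuc_greater[of \<kappa>] \<kappa> not_ordLess_ordLeq by blast
qed

lemma small_lists:
  assumes "|A| \<le>o \<kappa>"
  shows "|lists A| \<le>o \<kappa>"
proof -
  have "|{xs \<in> lists A. length xs = n}| \<le>o \<kappa>" for n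
  proof (induction n)
    case 0
    have "{xs \<in> lists A. length xs = 0} = {[]}" by auto
    then show ?case using small_finite[of "{[]}"] by simp
  next
    case (Suc n)
    have "{xs \<in> lists A. length xs = Suc n} = (\<Union>x\<in>A. Cons x ` {xs \<in> lists A. length xs = n})"
      by (rule set_eqI, rename_tac xs, case_tac xs) auto
    then show ?case
      using small_UN[OF assms ordLeq_transitive[OF card_of_image Suc]] by simp
  qed
  then have "|\<Union>n. {xs \<in> lists A. length xs = n}| \<le>o \<kappa>"
    by (intro small_UN small_countable)
  moreover have "(\<Union>n. {xs \<in> lists A. length xs = n}) = lists A" by auto
  ultimately show ?thesis by simp
qed

text \<open>A closure in countably many rounds, each adding a covering member for every finite
  subset. Members are smaller than \<open>\<kappa>\<close>, so a round adds at most
  \<open>\<kappa>\<close> points.\<close>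

lemma self_covered_hull:
  assumes "A \<subseteq> X" "|A| \<le>o \<kappa>"
  shows "\<exists>P. A \<subseteq> P \<and> self_covered P \<and> |P| \<le>o \<kappa>"
proof -
  have "\<forall>B. \<exists>F. B \<subseteq> X \<and> finite B \<longrightarrow> F \<in> \<F> \<and> B \<subseteq> F" using cofinal by blast
  then obtain D where D: "\<And>B. B \<subseteq> X \<Longrightarrow> finite B \<Longrightarrow> D B \<in> \<F> \<and> B \<subseteq> D B" by metis
  define step where "step A = A \<union> (\<Union>xs\<in>lists A. D (set xs))" for A
  define Q where "Q n = (step ^^ n) A" for n
  have Q_Suc: "Q (Suc n) = step (Q n)" for n by (simp add: Q_def)
  have Q: "Q n \<subseteq> X \<and> |Q n| \<le>o \<kappa>" for n
  proof (induction n)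
    case (Suc n)
    have D_Q: "D (set xs) \<in> \<F>" if "xs \<in> lists (Q n)" for xs
      using that Suc D[of "set xs"] by auto
    have "|\<Union>xs\<in>lists (Q n). D (set xs)| \<le>o \<kappa>"
      using Suc D_Q small ordLess_imp_ordLeq by (intro small_UN small_lists) auto
    then have "|step (Q n)| \<le>o \<kappa>"
      unfolding step_def using Suc \<kappa> by (intro Un_Cinfinite_bound) auto
    moreover have "step (Q n) \<subseteq> X"
      unfolding step_def using Suc D_Q subset_X by blast
    ultimately show ?case by (simp add: Q_Suc)
  qed (use assms in \<open>simp add: Q_def\<close>)
  have mono: "mono Q"
    by (auto simp: mono_iff_le_Suc Q_Suc step_def)
  define P where "P = (\<Union>n. Q n)"
  have "\<exists>F\<in>\<F>. B \<subseteq> F \<and> F \<subseteq> P" if B: "B \<subseteq> P" "finite B" for B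
  proof -
    have "\<exists>n. B \<subseteq> Q n"
      using B(2,1)
    proof (induction B rule: finite_induct)
      case (insert x B)
      then obtain n m where "B \<subseteq> Q n" "x \<in> Q m" by (auto simp: P_def)
      then have "insert x B \<subseteq> Q (max n m)" using monoD[OF mono] by (meson insert_subset max.cobounded1 max.cobounded2 subset_iff)
      then show ?case by blast
    qed auto
    then obtain n where n: "B \<subseteq> Q n" by blast
    obtain xs where xs: "set xs = B" using finite_list[OF B(2)] by blast
    then have "D B \<subseteq> Q (Suc n)" using n by (auto simp: Q_Suc step_def)
    moreover have "D B \<in> \<F> \<and> B \<subseteq> D B" using D[of B] n Q B(2) by blast
    ultimately show ?thesis by (auto simp: P_def)
  qed
  moreover have "|P| \<le>o \<kappa>" unfolding P_def using Q by (intro small_UN small_countable) auto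
  moreover have "A \<subseteq> P" unfolding P_def using Q_def[of 0] by auto
  moreover have "P \<subseteq> X" unfolding P_def using Q by blast
  ultimately show ?thesis unfolding self_covered_def by blast
qed

section \<open>Sets with a common honest definition\<close>

definition nice :: "(mem_sort, mem_rel) fm \<Rightarrow> 'a set \<Rightarrow> bool" where
  "nice \<psi> P \<longleftrightarrow> self_covered P \<and> |P| \<le>o \<kappa> \<and> separates \<psi> (X - P) P"

lemma nice_subset_X: "nice \<psi> P \<Longrightarrow> P \<subseteq> X"
  by (simp add: nice_def self_covered_def)

definition cofinally_nice :: "(mem_sort, mem_rel) fm \<Rightarrow> bool" where
  "cofinally_nice \<psi> \<longleftrightarrow> (\<forall>A\<subseteq>X. |A| \<le>o \<kappa> \<longrightarrow> (\<exists>P. A \<subseteq> P \<and> nice \<psi> P))"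

text \<open>If every formula failed above some small \<open>A \<psi>\<close>, then the formula
  separating a hull of the union of all these sets would contradict its own failure.\<close>

lemma ex_cofinally_nice:
  assumes "\<not> shatters_tuple d"
  shows "\<exists>\<psi>. cofinally_nice \<psi>"
proof (rule ccontr)
  assume "\<not> ?thesis"
  then have "\<forall>\<psi>. \<exists>A\<subseteq>X. |A| \<le>o \<kappa> \<and> \<not> (\<exists>P. A \<subseteq> P \<and> nice \<psi> P)"
    unfolding cofinally_nice_def by blast
  then obtain A where A: "\<And>\<psi>. A \<psi> \<subseteq> X" "\<And>\<psi>. |A \<psi>| \<le>o \<kappa>" "\<And>\<psi> P. A \<psi> \<subseteq> P \<Longrightarrow> \<not> nice \<psi> P"
    by metis
  have small_A: "|\<Union>\<psi>. A \<psi>| \<le>o \<kappa>" by (intro small_UN small_countable A(2))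
  have "(\<Union>\<psi>. A \<psi>) \<subseteq> X" using A(1) by blast
  from self_covered_hull[OF this small_A] obtain P
    where P: "(\<Union>\<psi>. A \<psi>) \<subseteq> P" "self_covered P" "|P| \<le>o \<kappa>" by blast
  obtain \<psi> where "separates \<psi> (X - P) P" using self_covered_separated[OF P(2) assms] by blast
  then have "nice \<psi> P" using P by (simp add: nice_def)
  moreover have "A \<psi> \<subseteq> P" using P(1) by blast
  ultimately show False using A(3) by blast
qed

text \<open>More than \<open>\<kappa>\<close> points satisfy \<open>\<phi>\<close>, phrased so that
  fresh witnesses can be drawn directly.\<close>

definition many :: "('a \<Rightarrow> bool) \<Rightarrow> bool" where
  "many \<phi> \<longleftrightarrow> (\<forall>A\<subseteq>X. |A| \<le>o \<kappa> \<longrightarrow> (\<exists>y\<in>X - A. \<phi> y))"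

lemma many_mono: "many \<phi> \<Longrightarrow> (\<And>y. y \<in> X \<Longrightarrow> \<phi> y \<Longrightarrow> \<phi>' y) \<Longrightarrow> many \<phi>'"
  unfolding many_def by (metis DiffD1)

lemma manyD: "many \<phi> \<Longrightarrow> A \<subseteq> X \<Longrightarrow> |A| \<le>o \<kappa> \<Longrightarrow> \<exists>y\<in>X - A. \<phi> y"
  by (simp add: many_def)

lemma not_manyD: "\<not> many \<phi> \<Longrightarrow> \<exists>A. A \<subseteq> X \<and> |A| \<le>o \<kappa> \<and> (\<forall>y\<in>X - A. \<not> \<phi> y)"
  by (simp add: many_def)

text \<open>Exceptional sets for all \<open>i\<close> would unite to one that still has size at most
  \<open>\<kappa>\<close>.\<close>

lemma many_pigeonhole:
  assumes "many (\<lambda>y. \<exists>i\<in>I. \<phi> i y)" "|I| \<le>o \<kappa>"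
  shows "\<exists>i\<in>I. many (\<phi> i)"
proof (rule ccontr)
  assume "\<not> ?thesis"
  then have "\<forall>i\<in>I. \<exists>A. A \<subseteq> X \<and> |A| \<le>o \<kappa> \<and> (\<forall>y\<in>X - A. \<not> \<phi> i y)"
    using not_manyD by simp
  then obtain A where A: "\<And>i. i \<in> I \<Longrightarrow> A i \<subseteq> X" "\<And>i. i \<in> I \<Longrightarrow> |A i| \<le>o \<kappa>"
    "\<And>i y. i \<in> I \<Longrightarrow> y \<in> X - A i \<Longrightarrow> \<not> \<phi> i y" by metis
  have small_A: "|\<Union>i\<in>I. A i| \<le>o \<kappa>" by (intro small_UN assms(2) A(2))
  have "(\<Union>i\<in>I. A i) \<subseteq> X" using A(1) by blast
  from manyD[OF assms(1) this small_A]
  obtain y where "y \<in> X - (\<Union>i\<in>I. A i)" "\<exists>i\<in>I. \<phi> i y" by blast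
  then show False using A(3) by blast
qed

text \<open>
  \<open>big m \<E>\<close> says: for many \<open>y\<^sub>1\<close>, for many \<open>y\<^sub>2\<close>, \<dots>, for many \<open>y\<^sub>m\<close>, some member of \<open>\<E>\<close> contains
  \<open>y\<^sub>1, \<dots>, y\<^sub>m\<close>.
\<close>

primrec big :: "nat \<Rightarrow> 'a set set \<Rightarrow> bool" where
  "big 0 \<E> \<longleftrightarrow> \<E> \<noteq> {}"
| "big (Suc m) \<E> \<longleftrightarrow> many (\<lambda>y. big m {F \<in> \<E>. y \<in> F})"

lemma big_mono: "big m \<E> \<Longrightarrow> \<E> \<subseteq> \<E>' \<Longrightarrow> big m \<E>'"
proof (induction m arbitrary: \<E> \<E>')
  case (Suc m)
  have "big m {F \<in> \<E>'. y \<in> F}" if "big m {F \<in> \<E>. y \<in> F}" for y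
    by (rule Suc.IH[OF that]) (use Suc.prems(2) in blast)
  then show ?case using Suc.prems(1) many_mono by auto
qed auto

lemma big_Suc_imp_big:
  assumes "big (Suc m) \<E>"
  shows "big m \<E>"
proof -
  have "|{} :: 'a set| \<le>o \<kappa>" by (simp add: small_finite)
  from manyD[OF assms[unfolded big.simps] _ this]
  obtain y where "big m {F \<in> \<E>. y \<in> F}" by blast
  then show ?thesis by (rule big_mono) blast
qed

text \<open>The index first depends on the points chosen; \<open>many_pigeonhole\<close> makes it
  uniform one quantifier at a time, from the inside out.\<close>

lemma big_pigeonhole:
  assumes "big m \<E>" "\<E> \<subseteq> (\<Union>i\<in>I. \<E>' i)" "|I| \<le>o \<kappa>"
  shows "\<exists>i\<in>I. big m {F \<in> \<E>. F \<in> \<E>' i}"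
  using assms(1,2)
proof (induction m arbitrary: \<E>)
  case 0
  then show ?case by auto
next
  case (Suc m)
  have "many (\<lambda>y. \<exists>i\<in>I. big m {F \<in> {F \<in> \<E>. y \<in> F}. F \<in> \<E>' i})"
    using Suc.prems(1) unfolding big.simps
    by (rule many_mono) (rule Suc.IH, use Suc.prems(2) in auto)
  from many_pigeonhole[OF this assms(3)] obtain i where "i \<in> I"
    "many (\<lambda>y. big m {F \<in> {F \<in> \<E>. y \<in> F}. F \<in> \<E>' i})" by blast
  moreover have "{F \<in> {F \<in> \<E>. y \<in> F}. F \<in> \<E>' i} = {F \<in> {F \<in> \<E>. F \<in> \<E>' i}. y \<in> F}" for y by auto
  ultimately show ?case by auto
qed

lemma big_family: "big m \<F>"
proof -
  \<comment> \<open>Strengthened so that the finite set \<open>B\<close> collects the points chosen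
    so far.\<close>
  have "big m {F \<in> \<F>. B \<subseteq> F}" if "B \<subseteq> X" "finite B" for B
    using that
  proof (induction m arbitrary: B)
    case 0
    from cofinal[OF 0] show ?case by auto
  next
    case (Suc m)
    have "big m {F \<in> {F \<in> \<F>. B \<subseteq> F}. y \<in> F}" if "y \<in> X" for y
    proof -
      have "{F \<in> {F \<in> \<F>. B \<subseteq> F}. y \<in> F} = {F \<in> \<F>. insert y B \<subseteq> F}" by auto
      then show ?thesis using Suc.IH[of "insert y B"] Suc.prems that by simp
    qed
    moreover have "many (\<lambda>y. True)"
      using not_small_X unfolding many_def by (metis Diff_iff subset_antisym subset_iff)
    ultimately show ?case using many_mono by auto
  qed
  from this[of "{}"] show ?thesis by simp
qed

text \<open>Transfinite recursion along \<open>r\<close>: each stage is a nice set containing all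
  earlier stages and a new witness for every \<open>\<phi>\<close> in \<open>\<Phi>\<close>. Unions
  of earlier stages stay small because \<open>r \<le>o \<kappa>\<close>.\<close>

lemma nice_chain:
  fixes r :: "'i rel"
  assumes nice: "cofinally_nice \<psi>"
    and r: "Cinfinite r" "r \<le>o \<kappa>"
    and \<Phi>: "finite \<Phi>" "\<forall>\<phi>\<in>\<Phi>. many \<phi>"
  shows "\<exists>M. relChain r M \<and> (\<forall>i. nice \<psi> (M i)) \<and>
    (\<forall>i\<in>Field r. \<forall>\<phi>\<in>\<Phi>. \<exists>y. y \<in> (\<Union>j\<in>Field r. M j) - M i \<and> \<phi> y)"
proof -
  have "\<exists>P. A \<subseteq> P \<and> nice \<psi> P \<and> (\<forall>\<phi>\<in>\<Phi>. \<exists>y\<in>P - A. \<phi> y)" if A: "A \<subseteq> X" "|A| \<le>o \<kappa>" for A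
  proof -
    have "\<forall>\<phi>\<in>\<Phi>. \<exists>y\<in>X - A. \<phi> y" using manyD[OF _ A] \<Phi>(2) by simp
    then obtain w where w: "\<And>\<phi>. \<phi> \<in> \<Phi> \<Longrightarrow> w \<phi> \<in> X - A \<and> \<phi> (w \<phi>)" by metis
    have "|A \<union> w ` \<Phi>| \<le>o \<kappa>"
      using A(2) \<kappa> \<Phi>(1) by (intro Un_Cinfinite_bound) (auto intro: small_finite)
    moreover have "A \<union> w ` \<Phi> \<subseteq> X" using A(1) w by blast
    ultimately obtain P where "A \<union> w ` \<Phi> \<subseteq> P" "nice \<psi> P"
      using nice[unfolded cofinally_nice_def, rule_format, of "A \<union> w ` \<Phi>"] by blast
    moreover from this have "A \<subseteq> P" "\<forall>\<phi>\<in>\<Phi>. w \<phi> \<in> P" by auto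
    ultimately show ?thesis using w by (intro exI[of _ P]) fast
  qed
  then obtain next_set where next_set: "\<And>A. A \<subseteq> X \<Longrightarrow> |A| \<le>o \<kappa> \<Longrightarrow>
      A \<subseteq> next_set A \<and> nice \<psi> (next_set A) \<and> (\<forall>\<phi>\<in>\<Phi>. \<exists>y\<in>next_set A - A. \<phi> y)"
    by metis
  have wf: "wf (r - Id)"
    using r(1) by (auto simp: card_order_on_def well_order_on_def)
  define M where "M = wfrec (r - Id) (\<lambda>f i. next_set (\<Union>j\<in>underS r i. f j))"
  have M: "M i = next_set (\<Union>j\<in>underS r i. M j)" for i
  proof -
    have "(\<Union>j\<in>underS r i. cut M (r - Id) i j) = (\<Union>j\<in>underS r i. M j)"
      by (rule SUP_cong) (auto simp: underS_def cut_apply)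
    then show ?thesis using wfrec[OF wf, of "\<lambda>f i. next_set (\<Union>j\<in>underS r i. f j)" i]
      unfolding M_def by simp
  qed
  have Field_r: "|Field r| \<le>o \<kappa>"
    using r card_of_Field_ordIso ordIso_ordLeq_trans by blast
  have underS: "|underS r i| \<le>o \<kappa>" for i
    by (rule small_subset[OF Field_r]) (auto simp: underS_def Field_def)
  have nice_M: "nice \<psi> (M i)" for i
    using wf
  proof (induction i rule: wf_induct_rule)
    case (less i)
    have IH: "nice \<psi> (M j)" if "j \<in> underS r i" for j
      using less that by (auto simp: underS_def)
    then have "|\<Union>j\<in>underS r i. M j| \<le>o \<kappa>"
      by (intro small_UN underS) (simp add: nice_def)
    moreover have "(\<Union>j\<in>underS r i. M j) \<subseteq> X"
      using IH nice_subset_X by blast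
    ultimately show ?case using next_set M by metis
  qed
  have next_M: "(\<Union>j\<in>underS r i. M j) \<subseteq> M i \<and> (\<forall>\<phi>\<in>\<Phi>. \<exists>y\<in>M i - (\<Union>j\<in>underS r i. M j). \<phi> y)" for i
  proof -
    have "|\<Union>j\<in>underS r i. M j| \<le>o \<kappa>"
      using nice_M by (intro small_UN underS) (simp add: nice_def)
    moreover have "(\<Union>j\<in>underS r i. M j) \<subseteq> X"
      using nice_M nice_subset_X by blast
    ultimately show ?thesis using next_set M by metis
  qed
  have "relChain r M"
    unfolding relChain_def
  proof (intro allI impI)
    fix i j assume "(i, j) \<in> r"
    then have "i = j \<or> i \<in> underS r j" by (auto simp: underS_def)
    then show "M i \<subseteq> M j" using conjunct1[OF next_M[of j]] by blast
  qed
  moreover have "\<exists>y. y \<in> (\<Union>j\<in>Field r. M j) - M i \<and> \<phi> y" if i: "i \<in> Field r" and \<phi>: "\<phi> \<in> \<Phi>" for i \<phi>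
  proof -
    \<comment> \<open>An infinite cardinal has no last element, and witnesses added at a later stage
      \<open>k\<close> avoid \<open>M i\<close>.\<close>
    obtain k where k: "k \<in> Field r" "i \<noteq> k" "(i, k) \<in> r"
      using infinite_Card_order_limit[of r i] r(1) i by (auto simp: cinfinite_def)
    then have "i \<in> underS r k" by (simp add: underS_def)
    moreover obtain y where "y \<in> M k - (\<Union>j\<in>underS r k. M j)" "\<phi> y"
      using conjunct2[OF next_M[of k]] \<phi> by blast
    ultimately show ?thesis using k(1) by blast
  qed
  ultimately show ?thesis using nice_M by blast
qed

text \<open>Hits spend one quantifier of \<open>big (Suc m)\<close> on the point
  \<open>y \<E>\<close>; misses come from confining \<open>F \<inter> W\<close> to a stage of the
  chain. One pair \<open>C\<close>, \<open>H\<close> must serve all families.\<close>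

lemma split_all:
  fixes r :: "'i rel"
  assumes nice: "cofinally_nice \<psi>"
    and r: "Cinfinite r" "regularCard r" "r \<le>o \<kappa>"
    and \<C>: "finite \<C>" "\<forall>\<E>\<in>\<C>. big (Suc m) \<E>"
      "\<forall>\<E>\<in>\<C>. \<forall>F\<in>\<E>. |F| <o r"
  shows "\<exists>C\<in>\<F>. \<exists>H\<in>instances \<psi>. \<forall>\<E>\<in>\<C>.
    big m {F \<in> \<E>. F \<inter> (C \<inter> H) = {}} \<and> big m {F \<in> \<E>. F \<inter> (C \<inter> H) \<noteq> {}}"
proof -
  define \<phi> where "\<phi> \<E> y \<longleftrightarrow> big m {F \<in> \<E>. y \<in> F}" for \<E> y
  have "\<forall>\<phi>'\<in>\<phi> ` \<C>. many \<phi>'"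
    using \<C>(2) by (auto simp: \<phi>_def[abs_def])
  from nice_chain[OF nice r(1,3) finite_imageI[OF \<C>(1)] this]
  obtain M where M_props: "relChain r M \<and> (\<forall>i. nice \<psi> (M i)) \<and>
    (\<forall>i\<in>Field r. \<forall>\<phi>'\<in>\<phi> ` \<C>. \<exists>y. y \<in> (\<Union>j\<in>Field r. M j) - M i \<and> \<phi>' y)" ..
  then have chain: "relChain r M" and M: "\<And>i. nice \<psi> (M i)" by simp_all
  have wit: "\<exists>y. y \<in> (\<Union>j\<in>Field r. M j) - M i \<and> \<phi> \<E> y" if "i \<in> Field r" "\<E> \<in> \<C>" for i \<E>
    using M_props that by (simp only: ball_simps)
  define W where "W = (\<Union>j\<in>Field r. M j)"
  have Card_r: "Card_order r" and Well_r: "Well_order r"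
    using r(1) card_order_on_well_order_on by auto
  have Field_r: "|Field r| \<le>o \<kappa>"
    using r card_of_Field_ordIso ordIso_ordLeq_trans by blast
  have Field_nonempty: "Field r \<noteq> {}" using r(1) by (auto simp: cinfinite_def)
  have bound: "\<exists>i\<in>Field r. B \<subseteq> M i" if "B \<subseteq> W" "|B| <o r" for B
    using regularCard_UNION[OF Card_r r(2) chain] that unfolding W_def by blast
  \<comment> \<open>Regularity of \<open>r\<close> puts each \<open>F \<inter> W\<close> inside some
    stage; as there are at most \<open>\<kappa>\<close> stages, one of them serves a big
    subfamily.\<close>
  have "\<forall>\<E>\<in>\<C>. \<exists>i\<in>Field r. big m {F \<in> \<E>. F \<inter> W \<subseteq> M i}"
  proof
    fix \<E> assume \<E>: "\<E> \<in> \<C>"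
    have "\<E> \<subseteq> (\<Union>i\<in>Field r. {F. F \<inter> W \<subseteq> M i})"
    proof
      fix F assume "F \<in> \<E>"
      then have "|F \<inter> W| <o r"
        using \<C>(3) \<E> card_of_mono1[of "F \<inter> W" F] ordLeq_ordLess_trans by blast
      then show "F \<in> (\<Union>i\<in>Field r. {F. F \<inter> W \<subseteq> M i})" using bound by blast
    qed
    from big_pigeonhole[OF big_Suc_imp_big[OF \<C>(2)[rule_format, OF \<E>]] this Field_r]
    show "\<exists>i\<in>Field r. big m {F \<in> \<E>. F \<inter> W \<subseteq> M i}" by simp
  qed
  then obtain i where i: "\<And>\<E>. \<E> \<in> \<C> \<Longrightarrow> i \<E> \<in> Field r \<and> big m {F \<in> \<E>. F \<inter> W \<subseteq> M (i \<E>)}"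
    by metis
  have "\<exists>k\<in>Field r. \<forall>\<E>\<in>\<C>. M (i \<E>) \<subseteq> M k"
    using \<C>(1) i
  proof (induction \<C> rule: finite_induct)
    case empty
    then show ?case using Field_nonempty by auto
  next
    case (insert \<E> \<C>)
    then obtain k where k: "k \<in> Field r" "\<forall>\<E>\<in>\<C>. M (i \<E>) \<subseteq> M k" by auto
    have "(k, i \<E>) \<in> r \<or> (i \<E>, k) \<in> r"
      using wo_rel.TOTALS[of r] Well_r k(1) insert.prems by (auto simp: wo_rel_def)
    then have "M k \<subseteq> M (i \<E>) \<or> M (i \<E>) \<subseteq> M k" using chain by (auto simp: relChain_def)
    then show ?case
    proof
      assume "M k \<subseteq> M (i \<E>)"
      then have "\<forall>\<E>'\<in>insert \<E> \<C>. M (i \<E>') \<subseteq> M (i \<E>)" using k(2) by blast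
      then show ?case using insert.prems by blast
    next
      assume "M (i \<E>) \<subseteq> M k"
      then have "\<forall>\<E>'\<in>insert \<E> \<C>. M (i \<E>') \<subseteq> M k" using k(2) by blast
      then show ?case using k(1) by blast
    qed
  qed
  then obtain k where k: "k \<in> Field r" "\<And>\<E>. \<E> \<in> \<C> \<Longrightarrow> M (i \<E>) \<subseteq> M k" by blast
  have miss: "big m {F \<in> \<E>. F \<inter> W \<subseteq> M k}" if "\<E> \<in> \<C>" for \<E>
    using i[OF that] by (blast intro: big_mono dest: k(2)[OF that, THEN subsetD])
  obtain y where y: "\<And>\<E>. \<E> \<in> \<C> \<Longrightarrow> y \<E> \<in> W - M k \<and> \<phi> \<E> (y \<E>)"
    using wit[OF k(1)] unfolding W_def by metis
  let ?Y = "y ` \<C>"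
  have "W \<subseteq> X" using M nice_subset_X unfolding W_def by blast
  then have Y: "?Y \<subseteq> X - M k" "?Y \<subseteq> W" "finite ?Y" using y \<C>(1) by auto
  \<comment> \<open>The honest definition at stage \<open>k\<close> covers the chosen points while
    avoiding the traces \<open>F \<inter> W\<close> confined to \<open>M k\<close>.\<close>
  obtain H where H: "H \<in> instances \<psi>" "?Y \<subseteq> H" "H \<inter> M k = {}"
    using M[of k] Y unfolding nice_def separates_def by blast
  have "|?Y| <o r"
    by (rule finite_ordLess_infinite[OF card_of_Well_order Well_r])
      (use Y(3) r(1) in \<open>simp_all add: cinfinite_def Field_card_of\<close>)
  \<comment> \<open>A stage containing all chosen points lets \<open>C\<close> be taken inside
    \<open>W\<close>, where the sets \<open>F\<close> are under control.\<close>
  then obtain j where j: "j \<in> Field r" "?Y \<subseteq> M j" using bound Y(2) by blast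
  then obtain C where C: "C \<in> \<F>" "?Y \<subseteq> C" "C \<subseteq> M j"
    using M[of j] Y(3) unfolding nice_def self_covered_def by blast
  have "C \<subseteq> W" using C(3) j(1) by (auto simp: W_def)
  have "big m {F \<in> \<E>. F \<inter> (C \<inter> H) = {}} \<and> big m {F \<in> \<E>. F \<inter> (C \<inter> H) \<noteq> {}}" if \<E>: "\<E> \<in> \<C>" for \<E>
  proof
    show "big m {F \<in> \<E>. F \<inter> (C \<inter> H) = {}}"
      using miss[OF \<E>] by (rule big_mono) (use H(3) \<open>C \<subseteq> W\<close> in blast)
    have "big m {F \<in> \<E>. y \<E> \<in> F}" using y[OF \<E>] by (simp add: \<phi>_def)
    then show "big m {F \<in> \<E>. F \<inter> (C \<inter> H) \<noteq> {}}"
      by (rule big_mono) (use \<E> H(2) C(2) in blast)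
  qed
  then show ?thesis using C(1) H(1) by blast
qed

text \<open>Each split doubles the number of families, and the next pair must split all of them;
  hence the induction over finite sets of families. Every pattern of hits then keeps a nonempty
  part.\<close>

lemma independent_hits:
  fixes r :: "'i rel"
  assumes nice: "cofinally_nice \<psi>"
    and r: "Cinfinite r" "regularCard r" "r \<le>o \<kappa>"
    and \<C>: "finite \<C>" "\<forall>\<E>\<in>\<C>. big n \<E>"
      "\<forall>\<E>\<in>\<C>. \<forall>F\<in>\<E>. |F| <o r"
  shows "\<exists>K. (\<forall>i<n. K i \<in> {C \<inter> H | C H. C \<in> \<F> \<and> H \<in> instances \<psi>}) \<and>
    (\<forall>\<E>\<in>\<C>. \<forall>S\<subseteq>{..<n}. \<exists>F\<in>\<E>. \<forall>i<n. F \<inter> K i \<noteq> {} \<longleftrightarrow> i \<in> S)"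
  using \<C>
proof (induction n arbitrary: \<C>)
  case 0
  then show ?case by (simp add: ex_in_conv)
next
  case (Suc n)
  obtain C H where CH: "C \<in> \<F>" "H \<in> instances \<psi>"
    and split: "\<And>\<E>. \<E> \<in> \<C> \<Longrightarrow> big n {F \<in> \<E>. F \<inter> (C \<inter> H) = {}}"
      "\<And>\<E>. \<E> \<in> \<C> \<Longrightarrow> big n {F \<in> \<E>. F \<inter> (C \<inter> H) \<noteq> {}}"
    using split_all[OF nice r Suc.prems] by auto
  define part where "part c \<E> = {F \<in> \<E>. F \<inter> (C \<inter> H) \<noteq> {} \<longleftrightarrow> c}" for c \<E>
  have big: "big n (part c \<E>)" if "\<E> \<in> \<C>" for c \<E>
    using split[OF that] by (cases c) (simp_all add: part_def)
  have "\<exists>K. (\<forall>i<n. K i \<in> {C \<inter> H | C H. C \<in> \<F> \<and> H \<in> instances \<psi>}) \<and>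
    (\<forall>\<E>\<in>(\<Union>c. part c ` \<C>). \<forall>S\<subseteq>{..<n}. \<exists>F\<in>\<E>. \<forall>i<n. F \<inter> K i \<noteq> {} \<longleftrightarrow> i \<in> S)"
  proof (rule Suc.IH)
    show "finite (\<Union>c. part c ` \<C>)" using Suc.prems(1) by simp
    show "\<forall>\<E>\<in>(\<Union>c. part c ` \<C>). big n \<E>" using big by blast
    show "\<forall>\<E>\<in>(\<Union>c. part c ` \<C>). \<forall>F\<in>\<E>. |F| <o r"
      using Suc.prems(3) by (auto simp: part_def)
  qed
  then obtain K where K_props: "(\<forall>i<n. K i \<in> {C \<inter> H | C H. C \<in> \<F> \<and> H \<in> instances \<psi>}) \<and>
    (\<forall>\<E>\<in>(\<Union>c. part c ` \<C>). \<forall>S\<subseteq>{..<n}. \<exists>F\<in>\<E>. \<forall>i<n. F \<inter> K i \<noteq> {} \<longleftrightarrow> i \<in> S)" ..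
  then have K: "\<forall>i<n. K i \<in> {C \<inter> H | C H. C \<in> \<F> \<and> H \<in> instances \<psi>}" ..
  have pat: "\<exists>F\<in>part c \<E>. \<forall>i<n. F \<inter> K i \<noteq> {} \<longleftrightarrow> i \<in> S" if "\<E> \<in> \<C>" "S \<subseteq> {..<n}" for c \<E> S
    using conjunct2[OF K_props] that by simp
  let ?K = "case_nat (C \<inter> H) K"
  have "\<exists>F\<in>\<E>. \<forall>i<Suc n. F \<inter> ?K i \<noteq> {} \<longleftrightarrow> i \<in> S" if "\<E> \<in> \<C>" "S \<subseteq> {..<Suc n}" for \<E> S
  proof -
    have "{i. Suc i \<in> S} \<subseteq> {..<n}" using that(2) by auto
    from pat[OF that(1) this, of "0 \<in> S"] obtain F where
      F: "F \<in> part (0 \<in> S) \<E>" "\<forall>i<n. F \<inter> K i \<noteq> {} \<longleftrightarrow> Suc i \<in> S" by auto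
    then show ?thesis by (intro bexI[of _ F]) (auto simp: part_def All_less_Suc2)
  qed
  moreover have "\<forall>i<Suc n. ?K i \<in> {C \<inter> H | C H. C \<in> \<F> \<and> H \<in> instances \<psi>}"
    unfolding All_less_Suc2 using K CH by auto
  ultimately show ?case by blast
qed

text \<open>
  Bounding the cardinalities by some \<open>\<mu> < \<kappa>\<close> makes chains of length \<open>\<mu>\<^sup>+\<close> (or \<open>\<omega>\<close>) sufficient, so \<open>\<kappa>\<close> itself
  may be singular.
\<close>

lemma big_bounded_subfamily:
  "\<exists>a\<in>Field \<kappa>. big n {F \<in> \<F>. |F| \<le>o |underS \<kappa> a|}"
proof -
  have "\<F> \<subseteq> (\<Union>a\<in>Field \<kappa>. {F. |F| \<le>o |underS \<kappa> a|})"
  proof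
    fix F assume "F \<in> \<F>"
    \<comment> \<open>Being smaller than \<open>\<kappa>\<close>, the cardinal of \<open>F\<close>
      is isomorphic to a proper initial segment of \<open>\<kappa>\<close>.\<close>
    then obtain a where a: "a \<in> Field \<kappa>" "|F| =o Restr \<kappa> (underS \<kappa> a)"
      using ordLess_iff_ordIso_Restr[of \<kappa> "|F|"] small \<kappa> card_of_Well_order card_order_on_well_order_on
      by blast
    have "|F| =o |Field (Restr \<kappa> (underS \<kappa> a))|"
      using a(2) card_of_Card_order Card_order_ordIso2 card_of_Field_ordIso ordIso_symmetric ordIso_transitive
      by blast
    moreover have "|Field (Restr \<kappa> (underS \<kappa> a))| \<le>o |underS \<kappa> a|"
      by (rule card_of_mono1) (auto simp: Field_def)
    ultimately show "F \<in> (\<Union>a\<in>Field \<kappa>. {F. |F| \<le>o |underS \<kappa> a|})"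
      using a(1) ordIso_ordLeq_trans by blast
  qed
  moreover have "|Field \<kappa>| \<le>o \<kappa>" using \<kappa> card_of_Field_ordIso ordIso_iff_ordLeq by blast
  ultimately have "\<exists>a\<in>Field \<kappa>. big n {F \<in> \<F>. F \<in> {F. |F| \<le>o |underS \<kappa> a|}}"
    by (rule big_pigeonhole[OF big_family])
  then show ?thesis by simp
qed

theorem has_IP_mem_struct: "has_IP N"
proof (cases "\<forall>d. shatters_tuple d")
  case True
  \<comment> \<open>Hitting a singleton is membership, so shattered tuples of points give
    independent hits.\<close>
  show ?thesis
  proof (rule has_IP_if_hits_independent[OF unif_definable_singletons])
    fix n :: nat
    have "shatters_tuple n" using True ..
    then obtain xs where xs: "length xs = n" "set xs \<subseteq> X"
      and pat: "\<forall>cs. length cs = n \<longrightarrow> (\<exists>F\<in>\<F>. \<forall>i<n. xs ! i \<in> F \<longleftrightarrow> cs ! i)"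
      unfolding shatters_tuple_def by blast
    have "\<exists>F\<in>\<F>. \<forall>i<n. F \<inter> {xs ! i} \<noteq> {} \<longleftrightarrow> i \<in> S" for S
      using pat[rule_format, of "map (\<lambda>i. i \<in> S) [0..<n]"] by auto
    moreover have "\<forall>i<n. {xs ! i} \<in> {{x} | x. x \<in> X}" using xs nth_mem by blast
    ultimately show "\<exists>K. (\<forall>i<n. K i \<in> {{x} | x. x \<in> X}) \<and>
        (\<forall>S\<subseteq>{..<n}. \<exists>F\<in>\<F>. \<forall>i<n. F \<inter> K i \<noteq> {} \<longleftrightarrow> i \<in> S)"
      by (intro exI[of _ "\<lambda>i. {xs ! i}"]) blast
  qed
next
  case False
  then obtain \<psi> where nice: "cofinally_nice \<psi>"
    using ex_cofinally_nice by blast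
  \<comment> \<open>Any nice set certifies that \<open>\<psi>\<close> is well sorted.\<close>
  then obtain P where "nice \<psi> P"
    using small_finite[of "{} :: 'a set"] unfolding cofinally_nice_def by blast
  then have "well_sorted (rank N) \<psi>" by (simp add: nice_def separates_def)
  then have "unif_definable (instances \<psi>)" unfolding unif_definable_def by blast
  with unif_definable_family
  have "unif_definable {C \<inter> H | C H. C \<in> \<F> \<and> H \<in> instances \<psi>}" by (rule unif_definable_Int)
  then show ?thesis
  proof (rule has_IP_if_hits_independent)
    fix n
    obtain a where a: "a \<in> Field \<kappa>" "big n {F \<in> \<F>. |F| \<le>o |underS \<kappa> a|}"
      using big_bounded_subfamily by blast
    let ?\<E> = "{F \<in> \<F>. |F| \<le>o |underS \<kappa> a|}"
    let ?goal = "\<exists>K. (\<forall>i<n. K i \<in> {C \<inter> H | C H. C \<in> \<F> \<and> H \<in> instances \<psi>}) \<and>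
      (\<forall>\<E>\<in>{?\<E>}. \<forall>S\<subseteq>{..<n}. \<exists>F\<in>\<E>. \<forall>i<n. F \<inter> K i \<noteq> {} \<longleftrightarrow> i \<in> S)"
    have ?goal
    proof (cases "finite (underS \<kappa> a)")
      case True
      show ?thesis
      proof (rule independent_hits[OF nice natLeq_Cinfinite regularCard_natLeq natLeq_ordLeq_cinfinite[OF \<kappa>]])
        show "\<forall>\<E>\<in>{?\<E>}. \<forall>F\<in>\<E>. |F| <o natLeq"
          using card_of_ordLeq_finite True finite_iff_ordLess_natLeq by auto
      qed (use a in auto)
    next
      case False
      let ?r = "|underS \<kappa> a|"
      have inf: "Cinfinite ?r" using False by (simp add: cinfinite_def Field_card_of card_of_card_order_on)
      \<comment> \<open>A proper initial segment of a cardinal is smaller than it, so the successor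
        of its size, which is regular, does not exceed \<open>\<kappa>\<close>.\<close>
      have "cardSuc ?r \<le>o \<kappa>"
        using \<kappa> a(1) by (intro cardSuc_least card_of_underS card_of_Card_order) auto
      then show ?thesis
      proof (rule independent_hits[OF nice Cinfinite_cardSuc[OF inf] regularCard_cardSuc[OF inf]])
        show "\<forall>\<E>\<in>{?\<E>}. \<forall>F\<in>\<E>. |F| <o cardSuc ?r"
          by (simp add: cardSuc_ordLeq_ordLess[OF card_of_Card_order card_of_Card_order])
      qed (use a in auto)
    qed
    then obtain K where K: "(\<forall>i<n. K i \<in> {C \<inter> H | C H. C \<in> \<F> \<and> H \<in> instances \<psi>}) \<and>
      (\<forall>\<E>\<in>{?\<E>}. \<forall>S\<subseteq>{..<n}. \<exists>F\<in>\<E>. \<forall>i<n. F \<inter> K i \<noteq> {} \<longleftrightarrow> i \<in> S)" ..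
    have "\<exists>F\<in>\<F>. \<forall>i<n. F \<inter> K i \<noteq> {} \<longleftrightarrow> i \<in> S" if S: "S \<subseteq> {..<n}" for S
    proof -
      obtain F where "F \<in> ?\<E>" "\<forall>i<n. F \<inter> K i \<noteq> {} \<longleftrightarrow> i \<in> S"
        using conjunct2[OF K, rule_format, OF singletonI S] ..
      then show ?thesis by (intro bexI[of _ F]) simp_all
    qed
    then have "\<forall>S\<subseteq>{..<n}. \<exists>F\<in>\<F>. \<forall>i<n. F \<inter> K i \<noteq> {} \<longleftrightarrow> i \<in> S"
      by (intro allI impI)
    with conjunct1[OF K] show "\<exists>K. (\<forall>i<n. K i \<in> {C \<inter> H | C H. C \<in> \<F> \<and> H \<in> instances \<psi>}) \<and>
        (\<forall>S\<subseteq>{..<n}. \<exists>F\<in>\<F>. \<forall>i<n. F \<inter> K i \<noteq> {} \<longleftrightarrow> i \<in> S)"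
      by (intro exI[of _ K] conjI)
  qed
qed

end

theorem theorem4p1:
  fixes \<kappa> :: "'k rel" and X :: "'a set" and \<F> :: "'a set set"
  assumes "Card_order \<kappa>" and "infinite (Field \<kappa>)"
    and "cardSuc \<kappa> \<le>o |X|"
    and "\<And>A. A \<in> \<F> \<Longrightarrow> A \<subseteq> X"
    and "\<And>A. A \<in> \<F> \<Longrightarrow> |A| <o \<kappa>"
    and "\<And>B. B \<subseteq> X \<Longrightarrow> finite B \<Longrightarrow> \<exists>A \<in> \<F>. B \<subseteq> A"
  shows "has_IP (mem_struct X \<F>)"
proof -
  have \<kappa>: "Cinfinite \<kappa>" using assms(1,2) by (simp add: cinfinite_def)
  have "Cinfinite (cardSuc \<kappa>)" using \<kappa> by (rule Cinfinite_cardSuc)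
  then have "infinite X"
    using cinfinite_mono[OF assms(3)] by (simp add: cinfinite_def Field_card_of)
  then interpret small_cofinal_family X \<F> \<kappa>
    using assms \<kappa> by unfold_locales auto
  show ?thesis by (rule has_IP_mem_struct)
qed

end
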